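(* Let $V$ be a finite-dimensional complex vector space, let $d\geq 2$, and let $T\in V^{\otimes d}$ be a symmetric $d$-way tensor of minimal border rank. Suppose there exists $\ell\in V^*$ such that the contraction $T(\ell^{\otimes (d-2)})\in V\otimes V$ is a full-rank symmetric matrix. Then $T$ is the ($d$-way) structure tensor of a smoothable Gorenstein algebra.
   Context: The border rank of $T\in V^{\otimes d}$ is the least $r$ such that $T$ is a limit of sums of $r$ decomposable tensors; $T$ has minimal border rank if its border rank equals $\dim V$. Algebras are associative, unital, commutative and finite-dimensional over $\mathbb C$. The $d$-way structure tensor of an algebra $A$ is the tensor $T_A\in (A^* )^{\otimes(d-1)}\otimes A$ corresponding to the multilinear map $(a_1,\dots,a_{d-1})\mapsto a_1\cdots a_{d-1}$. A tensor $T\in V^{\otimes d}$ is the $d$-way structure tensor of $A$ if it is isomorphic to $T_A$, i.e. there are linear isomorphisms $\phi_1,\dots,\phi_d$, with $\phi_i$ going between the $i$-th factors, such that $(\phi_1\otimes\cdots\otimes\phi_d)(T)=T_A$. An algebra $A$ with $\dim_{\mathbb C}A=m$ is smoothable if it is a degeneration of the standard product algebra $\mathbb C^{m}$; equivalently $\mathrm{Spec}(A)$ is a smoothable zero-dimensional scheme (a flat limit of $m$ distinct reduced points). A local algebra $(A,\mathfrak m)$ is Gorenstein if its socle $(0:\mathfrak m)$ is one-dimensional; $A$ is Gorenstein if its localization at every maximal ideal is local Gorenstein (equivalently, there is a linear form $e:A\to\mathbb C$ with $(a,b)\mapsto e(ab)$ a perfect pairing). *)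

theory Defs
  imports
    Complex_Main
    "HOL-Combinatorics.Permutations"
    "HOL-Algebra.Ideal"
begin

section \<open>Tensors\<close>

text \<open>
  A complex vector space is a type \<open>'v\<close> with a scalar multiplication \<open>scale\<close>. For finite-dimensional
  \<open>V\<close>, the space \<open>V\<^sup>\<otimes>\<^sup>d\<close> is identified with the \<open>d\<close>-linear forms on \<open>V\<^sup>*\<close>; such a form is a function
  on lists of functions \<open>'v \<Rightarrow> complex\<close>, of which only the values on the lists in \<open>dual_args scale d\<close>
  are meaningful. No definition below looks at any other value.
\<close>

definition dual :: "(complex \<Rightarrow> 'v::ab_group_add \<Rightarrow> 'v) \<Rightarrow> ('v \<Rightarrow> complex) set" where
  "dual scale = {\<alpha>. Vector_Spaces.linear scale (*) \<alpha>}"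

definition dual_args ::
    "(complex \<Rightarrow> 'v::ab_group_add \<Rightarrow> 'v) \<Rightarrow> nat \<Rightarrow> ('v \<Rightarrow> complex) list set" where
  "dual_args scale d = {\<alpha>s. length \<alpha>s = d \<and> set \<alpha>s \<subseteq> dual scale}"

type_synonym 'v tensor = "('v \<Rightarrow> complex) list \<Rightarrow> complex"

definition is_tensor :: "(complex \<Rightarrow> 'v::ab_group_add \<Rightarrow> 'v) \<Rightarrow> nat \<Rightarrow> 'v tensor \<Rightarrow> bool" where
  "is_tensor scale d T \<longleftrightarrow>
     (\<forall>\<alpha>s \<in> dual_args scale d. \<forall>i<d. \<forall>\<beta> \<in> dual scale. \<forall>\<gamma> \<in> dual scale. \<forall>b c.
        T (\<alpha>s[i := (\<lambda>v. b * \<beta> v + c * \<gamma> v)]) = b * T (\<alpha>s[i := \<beta>]) + c * T (\<alpha>s[i := \<gamma>]))"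

definition is_symmetric_tensor ::
    "(complex \<Rightarrow> 'v::ab_group_add \<Rightarrow> 'v) \<Rightarrow> nat \<Rightarrow> 'v tensor \<Rightarrow> bool" where
  "is_symmetric_tensor scale d T \<longleftrightarrow>
     is_tensor scale d T \<and>
     (\<forall>\<alpha>s \<in> dual_args scale d. \<forall>\<pi>. \<pi> permutes {..<d} \<longrightarrow> T (permute_list \<pi> \<alpha>s) = T \<alpha>s)"

definition is_decomposable ::
    "(complex \<Rightarrow> 'v::ab_group_add \<Rightarrow> 'v) \<Rightarrow> nat \<Rightarrow> 'v tensor \<Rightarrow> bool" where
  "is_decomposable scale d T \<longleftrightarrow>
     (\<exists>v :: nat \<Rightarrow> 'v. \<forall>\<alpha>s \<in> dual_args scale d. T \<alpha>s = (\<Prod>i<d. (\<alpha>s ! i) (v i)))"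

text \<open>
  As \<open>V\<^sup>\<otimes>\<^sup>d\<close> is finite-dimensional, its Euclidean topology is that of pointwise convergence of forms.
\<close>

definition is_limit_of_rank ::
    "(complex \<Rightarrow> 'v::ab_group_add \<Rightarrow> 'v) \<Rightarrow> nat \<Rightarrow> 'v tensor \<Rightarrow> nat \<Rightarrow> bool" where
  "is_limit_of_rank scale d T r \<longleftrightarrow>
     (\<exists>D :: nat \<Rightarrow> nat \<Rightarrow> 'v tensor.
        (\<forall>k. \<forall>j<r. is_decomposable scale d (D k j)) \<and>
        (\<forall>\<alpha>s \<in> dual_args scale d. (\<lambda>k. \<Sum>j<r. D k j \<alpha>s) \<longlonglongrightarrow> T \<alpha>s))"

definition border_rank ::
    "(complex \<Rightarrow> 'v::ab_group_add \<Rightarrow> 'v) \<Rightarrow> nat \<Rightarrow> 'v tensor \<Rightarrow> nat" where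
  "border_rank scale d T = (LEAST r. is_limit_of_rank scale d T r)"

definition minimal_border_rank ::
    "(complex \<Rightarrow> 'v::ab_group_add \<Rightarrow> 'v) \<Rightarrow> nat \<Rightarrow> 'v tensor \<Rightarrow> bool" where
  "minimal_border_rank scale d T \<longleftrightarrow> border_rank scale d T = vector_space.dim scale UNIV"

definition contract :: "nat \<Rightarrow> ('v \<Rightarrow> complex) \<Rightarrow> 'v tensor \<Rightarrow> 'v tensor" where
  "contract k l T = (\<lambda>\<alpha>s. T (replicate k l @ \<alpha>s))"

text \<open>
  The rank of \<open>M \<in> V \<otimes> V\<close> is the dimension of the image of the induced map \<open>V\<^sup>* \<rightarrow> V\<close>, which sends
  \<open>\<alpha>\<close> to the vector \<open>w\<close> with \<open>\<beta>(w) = M(\<alpha>, \<beta>)\<close> for all \<open>\<beta>\<close>.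
\<close>

definition matrix_rank :: "(complex \<Rightarrow> 'v::ab_group_add \<Rightarrow> 'v) \<Rightarrow> 'v tensor \<Rightarrow> nat" where
  "matrix_rank scale M =
     vector_space.dim scale {w. \<exists>\<alpha> \<in> dual scale. \<forall>\<beta> \<in> dual scale. \<beta> w = M [\<alpha>, \<beta>]}"

definition is_full_rank :: "(complex \<Rightarrow> 'v::ab_group_add \<Rightarrow> 'v) \<Rightarrow> 'v tensor \<Rightarrow> bool" where
  "is_full_rank scale M \<longleftrightarrow> matrix_rank scale M = vector_space.dim scale UNIV"


section \<open>Algebras\<close>

definition alg_ring :: "('a::ab_group_add \<Rightarrow> 'a \<Rightarrow> 'a) \<Rightarrow> 'a \<Rightarrow> 'a ring" where
  "alg_ring mul u = \<lparr>carrier = UNIV, mult = mul, one = u, zero = 0, add = (+)\<rparr>"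

text \<open>The zero algebra is allowed; it occurs for \<open>V = 0\<close>.\<close>

definition is_algebra ::
    "(complex \<Rightarrow> 'a::ab_group_add \<Rightarrow> 'a) \<Rightarrow> ('a \<Rightarrow> 'a \<Rightarrow> 'a) \<Rightarrow> 'a \<Rightarrow> bool" where
  "is_algebra scale mul u \<longleftrightarrow>
     (\<exists>B. finite_dimensional_vector_space scale B) \<and>
     cring (alg_ring mul u) \<and>
     (\<forall>c x y. mul (scale c x) y = scale c (mul x y))"

text \<open>
  \<open>T\<^sub>A \<in> (A\<^sup>*)\<^sup>\<otimes>\<^sup>(\<^sup>d\<^sup>-\<^sup>1\<^sup>) \<otimes> A\<close> as a \<open>d\<close>-linear form on \<open>A\<^sup>d\<^sup>-\<^sup>1 \<times> A\<^sup>*\<close>, using \<open>A\<^sup>*\<^sup>* = A\<close>; the list \<open>as\<close> has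
  length \<open>d - 1\<close>.
\<close>

definition structure_tensor ::
    "('a \<Rightarrow> 'a \<Rightarrow> 'a) \<Rightarrow> 'a \<Rightarrow> 'a list \<Rightarrow> ('a \<Rightarrow> complex) \<Rightarrow> complex" where
  "structure_tensor mul u as \<alpha> = \<alpha> (foldr mul as u)"

text \<open>
  The isomorphisms are \<open>\<phi> i : V \<rightarrow> A\<^sup>*\<close> for \<open>i < d - 1\<close> and \<open>\<psi> : V \<rightarrow> A\<close>. The form
  \<open>(\<phi>\<^sub>0 \<otimes> \<dots> \<otimes> \<psi>)(T)\<close> is \<open>T\<close> precomposed with the transposes, which send \<open>a \<in> A = A\<^sup>*\<^sup>*\<close> to
  \<open>v \<mapsto> \<phi> i v a\<close>, and \<open>\<alpha> \<in> A\<^sup>*\<close> to \<open>\<alpha> \<circ> \<psi>\<close>.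
\<close>

definition is_structure_tensor_of ::
    "(complex \<Rightarrow> 'v::ab_group_add \<Rightarrow> 'v) \<Rightarrow> nat \<Rightarrow> 'v tensor \<Rightarrow>
     (complex \<Rightarrow> 'a::ab_group_add \<Rightarrow> 'a) \<Rightarrow> ('a \<Rightarrow> 'a \<Rightarrow> 'a) \<Rightarrow> 'a \<Rightarrow> bool" where
  "is_structure_tensor_of scaleV d T scaleA mul u \<longleftrightarrow>
     (\<exists>(\<phi> :: nat \<Rightarrow> 'v \<Rightarrow> 'a \<Rightarrow> complex) (\<psi> :: 'v \<Rightarrow> 'a).
        (\<forall>i < d - 1. bij_betw (\<phi> i) UNIV (dual scaleA) \<and>
                     (\<forall>a. Vector_Spaces.linear scaleV (*) (\<lambda>v. \<phi> i v a))) \<and>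
        bij \<psi> \<and> Vector_Spaces.linear scaleV scaleA \<psi> \<and>
        (\<forall>as. length as = d - 1 \<longrightarrow> (\<forall>\<alpha> \<in> dual scaleA.
           T (map (\<lambda>i v. \<phi> i v (as ! i)) [0..<d - 1] @ [\<alpha> \<circ> \<psi>]) = structure_tensor mul u as \<alpha>)))"

definition std_space :: "nat \<Rightarrow> (nat \<Rightarrow> complex) set" where
  "std_space m = {f. \<forall>i\<ge>m. f i = 0}"

text \<open>
  \<open>A\<close> is a degeneration of \<open>\<complex>\<^sup>m\<close> if its multiplication is a limit of multiplications \<open>\<mu>\<^sub>k\<close> on the space
  \<open>A\<close>, each obtained by transporting the componentwise one along a linear isomorphism \<open>g k : A \<rightarrow> \<complex>\<^sup>m\<close>.
  (The orbit closure is the same in the Zariski and in the Euclidean topology.)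
\<close>

definition is_smoothable ::
    "(complex \<Rightarrow> 'a::ab_group_add \<Rightarrow> 'a) \<Rightarrow> ('a \<Rightarrow> 'a \<Rightarrow> 'a) \<Rightarrow> bool" where
  "is_smoothable scale mul \<longleftrightarrow>
     (\<exists>g :: nat \<Rightarrow> 'a \<Rightarrow> nat \<Rightarrow> complex.
        (\<forall>k. bij_betw (g k) UNIV (std_space (vector_space.dim scale UNIV)) \<and>
             (\<forall>i. Vector_Spaces.linear scale (*) (\<lambda>x. g k x i))) \<and>
        (\<forall>x y. \<forall>\<alpha> \<in> dual scale.
           (\<lambda>k. \<alpha> (inv_into UNIV (g k) (\<lambda>i. g k x i * g k y i))) \<longlonglongrightarrow> \<alpha> (mul x y)))"

text \<open>
  The localization of \<open>A\<close> at a maximal ideal \<open>\<mm>\<close> consists of the classes \<open>a/s\<close>, \<open>s \<notin> \<mm>\<close>. Its maximal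
  ideal is the set of all \<open>\<mu>/t\<close> with \<open>\<mu> \<in> \<mm>\<close> and \<open>t \<notin> \<mm>\<close>.
\<close>

definition loc_rel ::
    "('a::ab_group_add \<Rightarrow> 'a \<Rightarrow> 'a) \<Rightarrow> 'a set \<Rightarrow> (('a \<times> 'a) \<times> ('a \<times> 'a)) set" where
  "loc_rel mul \<mm> = {((a, s), (b, t)). s \<notin> \<mm> \<and> t \<notin> \<mm> \<and> (\<exists>r. r \<notin> \<mm> \<and> mul r (mul t a - mul s b) = 0)}"

definition loc_frac ::
    "('a::ab_group_add \<Rightarrow> 'a \<Rightarrow> 'a) \<Rightarrow> 'a set \<Rightarrow> 'a \<Rightarrow> 'a \<Rightarrow> ('a \<times> 'a) set" where
  "loc_frac mul \<mm> a s = loc_rel mul \<mm> `` {(a, s)}"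

definition loc_socle ::
    "('a::ab_group_add \<Rightarrow> 'a \<Rightarrow> 'a) \<Rightarrow> 'a \<Rightarrow> 'a set \<Rightarrow> ('a \<times> 'a) set set" where
  "loc_socle mul u \<mm> =
     {loc_frac mul \<mm> a s | a s. s \<notin> \<mm> \<and>
        (\<forall>\<mu> t. \<mu> \<in> \<mm> \<longrightarrow> t \<notin> \<mm> \<longrightarrow> loc_frac mul \<mm> (mul \<mu> a) (mul t s) = loc_frac mul \<mm> 0 u)}"

text \<open>One-dimensionality of the socle: it is the line spanned by some nonzero \<open>a/s\<close>.\<close>

definition is_gorenstein ::
    "(complex \<Rightarrow> 'a::ab_group_add \<Rightarrow> 'a) \<Rightarrow> ('a \<Rightarrow> 'a \<Rightarrow> 'a) \<Rightarrow> 'a \<Rightarrow> bool" where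
  "is_gorenstein scale mul u \<longleftrightarrow>
     (\<forall>\<mm>. maximalideal \<mm> (alg_ring mul u) \<longrightarrow>
        (\<exists>a s. s \<notin> \<mm> \<and> loc_frac mul \<mm> a s \<noteq> loc_frac mul \<mm> 0 u \<and>
               loc_socle mul u \<mm> = {loc_frac mul \<mm> (scale c a) s | c. True}))"

end

theory Submission
  imports Defs "HOL-Computational_Algebra.Fundamental_Theorem_Algebra"
begin

text \<open>
  Let \<open>M = T(\<ell>\<^sup>d\<^sup>-\<^sup>2)\<close>, seen as an isomorphism \<open>V\<^sup>* \<rightarrow> V\<close>, and \<open>P = M\<^sup>-\<^sup>1\<close>. For \<open>d \<ge> 3\<close> the product is
  \<open>x \<star> y = T(\<ell>\<^sup>d\<^sup>-\<^sup>3, P x, P y)\<close>, with unit \<open>M \<ell>\<close>; symmetry of \<open>T\<close> makes it commutative. Let \<open>T\<close> be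
  the limit of tensors \<open>T\<^sub>k\<close> of rank at most \<open>n = dim V\<close>. Since \<open>T\<^sub>k(\<ell>\<^sup>d\<^sup>-\<^sup>2)\<close> tends to \<open>M\<close>, it is invertible for
  large \<open>k\<close>, so the last factors of the \<open>n\<close> summands of \<open>T\<^sub>k\<close> form a basis of \<open>V\<close>, and \<open>\<ell>\<close> does not vanish on
  the first \<open>d - 2\<close> factors. Hence the operators obtained from \<open>T\<^sub>k\<close> by replacing one argument \<open>\<ell>\<close> by
  another functional are simultaneously diagonal. In the limit, multiplications commute, which together
  with commutativity gives associativity; products of \<open>d - 2\<close> of these operators converge to
  the multiplications in the structure tensor, and their eigenvalues give isomorphisms
  \<open>V \<rightarrow> \<complex>\<^sup>n\<close> whose transported products converge to \<open>\<star>\<close>. The form \<open>\<ell>(x \<star> y) = P x y\<close> is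
  nondegenerate, so the algebra is Gorenstein. For \<open>d = 2\<close> the structure tensor depends only
  on the underlying space, and the coordinatewise product will do.
\<close>

section \<open>Functionals and convergence in a finite-dimensional space\<close>

locale complex_fd = finite_dimensional_vector_space scale Basis
  for scale :: "complex \<Rightarrow> 'v::ab_group_add \<Rightarrow> 'v" and Basis :: "'v set"
begin

abbreviation V_dual :: "('v \<Rightarrow> complex) set" where "V_dual \<equiv> dual scale"

abbreviation V_linear :: "('v \<Rightarrow> 'v) \<Rightarrow> bool" where
  "V_linear \<equiv> Vector_Spaces.linear scale scale"

abbreviation coord :: "'v \<Rightarrow> 'v \<Rightarrow> complex" where
  "coord b v \<equiv> representation Basis v b"

lemma vector_space_complex: "vector_space ((*) :: complex \<Rightarrow> complex \<Rightarrow> complex)"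
  by unfold_locales (auto simp: algebra_simps)

lemma linear_form_iff:
  "Vector_Spaces.linear scale (*) f \<longleftrightarrow>
    (\<forall>x y. f (x + y) = f x + f y) \<and> (\<forall>c x. f (scale c x) = c * f x)"
  using vector_space_complex vector_space_axioms by (simp add: Vector_Spaces.linear_iff)

lemma dual_iff:
  "f \<in> V_dual \<longleftrightarrow> (\<forall>x y. f (x + y) = f x + f y) \<and> (\<forall>c x. f (scale c x) = c * f x)"
  by (simp add: dual_def linear_form_iff)

lemma dualI:
  assumes "\<And>x y. f (x + y) = f x + f y" "\<And>c x. f (scale c x) = c * f x"
  shows "f \<in> V_dual"
  using assms by (simp add: dual_iff)

lemma dual_add: "f \<in> V_dual \<Longrightarrow> f (x + y) = f x + f y"
  and dual_scale: "f \<in> V_dual \<Longrightarrow> f (scale c x) = c * f x"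
  by (simp_all add: dual_iff)

lemma dual_zero: "f \<in> V_dual \<Longrightarrow> f 0 = 0"
  using dual_scale[of f 0 0] by simp

lemma dual_diff: "f \<in> V_dual \<Longrightarrow> f (x - y) = f x - f y"
  using dual_add[of f "x - y" y] by (simp add: algebra_simps)

lemma dual_sum: "f \<in> V_dual \<Longrightarrow> f (\<Sum>i\<in>I. h i) = (\<Sum>i\<in>I. f (h i))"
  by (induction I rule: infinite_finite_induct) (auto simp: dual_zero dual_add)

lemma dual_lincomb: "f \<in> V_dual \<Longrightarrow> g \<in> V_dual \<Longrightarrow> (\<lambda>v. b * f v + c * g v) \<in> V_dual"
  by (auto simp: dual_iff algebra_simps)

lemma dual_scaled: "f \<in> V_dual \<Longrightarrow> (\<lambda>v. c * f v) \<in> V_dual"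
  by (auto simp: dual_iff algebra_simps)

lemma zero_dual: "(\<lambda>_. 0) \<in> V_dual"
  by (auto simp: dual_iff)

lemma sum_dual: "(\<And>i. i \<in> I \<Longrightarrow> h i \<in> V_dual) \<Longrightarrow> (\<lambda>v. \<Sum>i\<in>I. h i v) \<in> V_dual"
  by (auto simp: dual_iff sum.distrib sum_distrib_left)

lemma coord_dual: "coord b \<in> V_dual"
  by (rule dualI)
    (simp_all add: representation_add representation_scale independent_Basis span_Basis)

lemma coord_Basis: "b \<in> Basis \<Longrightarrow> coord c b = (if c = b then 1 else 0)"
  by (simp add: representation_basis[OF independent_Basis])

lemma sum_coord: "(\<Sum>b\<in>Basis. scale (coord b v) b) = v"
  by (rule sum_representation_eq) (auto simp: independent_Basis span_Basis finite_Basis)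

lemma dual_expand: "f \<in> V_dual \<Longrightarrow> f v = (\<Sum>b\<in>Basis. f b * coord b v)"
  by (subst sum_coord[of v, symmetric], simp only: dual_sum dual_scale) (simp add: mult.commute)

lemma dual_eqI: "(\<And>f. f \<in> V_dual \<Longrightarrow> f x = f y) \<Longrightarrow> x = y"
  by (metis (no_types, lifting) coord_dual sum.cong sum_coord)

lemma linearI_V:
  assumes "\<And>x y. f (x + y) = f x + f y" "\<And>c x. f (scale c x) = scale c (f x)"
  shows "V_linear f"
  using assms vector_space_axioms by (simp add: Vector_Spaces.linear_iff)

lemma V_linear_add: "V_linear f \<Longrightarrow> f (x + y) = f x + f y"
  and V_linear_scale: "V_linear f \<Longrightarrow> f (scale c x) = scale c (f x)"
  by (simp_all add: Vector_Spaces.linear_iff)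

lemma V_linear_zero: "V_linear f \<Longrightarrow> f 0 = 0"
  using V_linear_scale[of f 0 0] by simp

lemma V_linear_diff: "V_linear f \<Longrightarrow> f (x - y) = f x - f y"
  using V_linear_add[of f "x - y" y] by (simp add: algebra_simps)

lemma V_linear_sum: "V_linear f \<Longrightarrow> f (\<Sum>i\<in>I. h i) = (\<Sum>i\<in>I. f (h i))"
  by (induction I rule: infinite_finite_induct) (auto simp: V_linear_zero V_linear_add)

lemma V_linear_expand: "V_linear f \<Longrightarrow> f v = (\<Sum>b\<in>Basis. scale (coord b v) (f b))"
  by (subst sum_coord[of v, symmetric], simp only: V_linear_sum V_linear_scale)

lemma V_linear_inj: "V_linear f \<Longrightarrow> (\<And>x. f x = 0 \<Longrightarrow> x = 0) \<Longrightarrow> inj f"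
  by (metis V_linear_diff eq_iff_diff_eq_0 injI)

text \<open>\<open>G\<close> reassembles a coordinate tuple into a vector. The composite of
  \<open>F\<close> with \<open>G\<close> is an injective endomorphism of a finite-dimensional space,
  hence onto, and injectivity of \<open>G\<close> on \<open>std_space\<close> transfers this to
  \<open>F\<close>.\<close>

lemma injective_coordinates_bij:
  fixes F :: "'v \<Rightarrow> nat \<Rightarrow> complex"
  assumes lin: "\<And>i. (\<lambda>x. F x i) \<in> V_dual"
    and van: "\<And>x i. i \<ge> card Basis \<Longrightarrow> F x i = 0"
    and inj: "inj F"
  shows "bij_betw F UNIV (std_space (card Basis))"
proof -
  obtain s where s: "bij_betw s {..<card Basis} Basis"
    using ex_bij_betw_nat_finite[OF finite_Basis] by (auto simp: atLeast0LessThan)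
  define G where "G = (\<lambda>t::nat \<Rightarrow> complex. \<Sum>j<card Basis. scale (t j) (s j))"
  have G_coord: "coord (s j) (G t) = t j" if "j < card Basis" for t j
  proof -
    have "coord (s j) (G t) = (\<Sum>i<card Basis. t i * coord (s j) (s i))"
      unfolding G_def by (simp only: dual_sum[OF coord_dual] dual_scale[OF coord_dual])
    also have "\<dots> = (\<Sum>i<card Basis. if i = j then t i else 0)"
    proof (rule sum.cong)
      fix i assume i: "i \<in> {..<card Basis}"
      have "s i \<in> Basis" using s i by (auto dest: bij_betwE)
      moreover have "s j = s i \<longleftrightarrow> i = j"
        using s i that by (auto simp: bij_betw_def inj_on_def)
      ultimately show "t i * coord (s j) (s i) = (if i = j then t i else 0)"
        by (simp add: coord_Basis)
    qed simp
    finally show ?thesis using that by simp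
  qed
  have G_inj: "t = t'" if "t \<in> std_space (card Basis)" "t' \<in> std_space (card Basis)" "G t = G t'"
    for t t'
  proof
    fix j show "t j = t' j"
      using that G_coord[of j t] G_coord[of j t'] by (cases "j < card Basis") (auto simp: std_space_def)
  qed
  have F_std: "F x \<in> std_space (card Basis)" for x
    using van by (simp add: std_space_def)
  have "V_linear (\<lambda>x. G (F x))"
    using dual_add[OF lin] dual_scale[OF lin]
    by (intro linearI_V) (simp_all add: G_def scale_left_distrib sum.distrib scale_sum_right)
  moreover have "inj (\<lambda>x. G (F x))"
    using G_inj F_std inj by (auto simp: inj_def)
  ultimately have surj: "surj (\<lambda>x. G (F x))"
    by (rule linear_inj_imp_surj)
  have "t \<in> range F" if "t \<in> std_space (card Basis)" for t
  proof -
    obtain x where "G t = G (F x)" using surjD[OF surj, of "G t"] by (elim exE) blast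
    then have "t = F x" by (rule G_inj[OF that F_std])
    then show ?thesis by simp
  qed
  then show ?thesis using inj F_std by (auto simp: bij_betw_def)
qed

section \<open>Convergence of vectors, tested by functionals\<close>

definition wlim :: "(nat \<Rightarrow> 'v) \<Rightarrow> 'v \<Rightarrow> bool" where
  "wlim x y \<longleftrightarrow> (\<forall>\<beta>\<in>V_dual. (\<lambda>k. \<beta> (x k)) \<longlonglongrightarrow> \<beta> y)"

lemma wlimI: "(\<And>\<beta>. \<beta> \<in> V_dual \<Longrightarrow> (\<lambda>k. \<beta> (x k)) \<longlonglongrightarrow> \<beta> y) \<Longrightarrow> wlim x y"
  and wlimD: "wlim x y \<Longrightarrow> \<beta> \<in> V_dual \<Longrightarrow> (\<lambda>k. \<beta> (x k)) \<longlonglongrightarrow> \<beta> y"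
  by (auto simp: wlim_def)

lemma wlim_const: "wlim (\<lambda>_. x) x"
  by (simp add: wlim_def)

lemma wlim_unique: "wlim x y \<Longrightarrow> wlim x z \<Longrightarrow> y = z"
  by (rule dual_eqI) (meson LIMSEQ_unique wlimD)

lemma wlim_diff: "wlim x y \<Longrightarrow> wlim x' y' \<Longrightarrow> wlim (\<lambda>k. x k - x' k) (y - y')"
  by (simp add: wlim_def dual_diff tendsto_diff)

text \<open>Joint continuity of evaluation: after expansion in the finite basis,
  \<open>\<beta> (N k (z k))\<close> is a finite sum of products of convergent sequences.\<close>

lemma wlim_apply:
  assumes lin: "\<And>k. V_linear (N k)" "V_linear N'"
    and N: "\<And>x. wlim (\<lambda>k. N k x) (N' x)" and z: "wlim z y"
  shows "wlim (\<lambda>k. N k (z k)) (N' y)"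
proof (rule wlimI)
  fix \<beta> assume \<beta>: "\<beta> \<in> V_dual"
  have *: "\<beta> (h w) = (\<Sum>b\<in>Basis. coord b w * \<beta> (h b))" if "V_linear h" for h w
    by (subst V_linear_expand[OF that]) (simp only: dual_sum[OF \<beta>] dual_scale[OF \<beta>])
  show "(\<lambda>k. \<beta> (N k (z k))) \<longlonglongrightarrow> \<beta> (N' y)"
    unfolding *[OF lin(1), of _ "z _"] *[OF lin(2), of y]
    by (intro tendsto_sum tendsto_mult wlimD[OF z coord_dual] wlimD[OF N \<beta>])
qed

section \<open>The coordinate sum norm and operators close to the identity\<close>

definition cnorm :: "'v \<Rightarrow> real" where
  "cnorm v = (\<Sum>b\<in>Basis. cmod (coord b v))"

lemma cnorm_nonneg: "cnorm v \<ge> 0"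
  by (simp add: cnorm_def sum_nonneg)

lemma cnorm_zero: "cnorm 0 = 0"
  by (simp add: cnorm_def dual_zero[OF coord_dual])

lemma cnorm_eq_0: "cnorm v = 0 \<Longrightarrow> v = 0"
  using sum_coord[of v] by (simp add: cnorm_def sum_nonneg_eq_0_iff finite_Basis)

lemma cnorm_add: "cnorm (v + w) \<le> cnorm v + cnorm w"
  unfolding cnorm_def dual_add[OF coord_dual] sum.distrib[symmetric]
  by (intro sum_mono norm_triangle_ineq)

lemma cnorm_scale: "cnorm (scale c v) = cmod c * cnorm v"
  by (simp add: cnorm_def dual_scale[OF coord_dual] norm_mult sum_distrib_left)

lemma cnorm_sum: "cnorm (\<Sum>i\<in>I. h i) \<le> (\<Sum>i\<in>I. cnorm (h i))"
proof (induction I rule: infinite_finite_induct)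
  case (insert i I)
  then show ?case using cnorm_add[of "h i" "\<Sum>i\<in>I. h i"] by auto
qed (auto simp: cnorm_zero)

text \<open>Every functional is a finite combination of coordinates, so convergence against
  functionals is norm convergence.\<close>

lemma wlim_cnorm: "wlim x y \<longleftrightarrow> (\<lambda>k. cnorm (x k - y)) \<longlonglongrightarrow> 0"
proof
  assume x: "wlim x y"
  have "(\<lambda>k. cnorm (x k - y)) \<longlonglongrightarrow> (\<Sum>b\<in>Basis. cmod (coord b y - coord b y))"
    unfolding cnorm_def dual_diff[OF coord_dual]
    by (intro tendsto_intros wlimD[OF x coord_dual])
  then show "(\<lambda>k. cnorm (x k - y)) \<longlonglongrightarrow> 0" by simp
next
  assume x: "(\<lambda>k. cnorm (x k - y)) \<longlonglongrightarrow> 0"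
  show "wlim x y"
  proof (rule wlimI)
    fix \<beta> assume \<beta>: "\<beta> \<in> V_dual"
    have co: "(\<lambda>k. coord b (x k)) \<longlonglongrightarrow> coord b y" if "b \<in> Basis" for b
    proof -
      have "cmod (coord b (x k) - coord b y) \<le> cnorm (x k - y)" for k
        unfolding cnorm_def dual_diff[OF coord_dual]
        using that finite_Basis by (intro member_le_sum) auto
      then have "(\<lambda>k. coord b (x k) - coord b y) \<longlonglongrightarrow> 0"
        by (intro tendsto_0_le[OF x, where K=1]) (simp add: cnorm_nonneg)
      then show ?thesis by (simp add: LIM_zero_iff)
    qed
    show "(\<lambda>k. \<beta> (x k)) \<longlonglongrightarrow> \<beta> y"
      unfolding dual_expand[OF \<beta>, of "x _"] dual_expand[OF \<beta>, of y]
      by (intro tendsto_intros co)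
  qed
qed

text \<open>Convergence on the finitely many basis vectors makes the operator norm of
  \<open>N k\<close> minus the identity tend to 0. Once it is below 1/2, the triangle inequality
  bounds \<open>z\<close> by its image, uniformly in \<open>z\<close>.\<close>

lemma near_identity:
  assumes lin: "\<And>k. V_linear (N k)" and N: "\<And>x. wlim (\<lambda>k. N k x) x"
  shows "eventually (\<lambda>k. \<forall>z. cnorm z \<le> 2 * cnorm (N k z)) sequentially"
proof -
  \<comment> \<open>\<open>e k\<close> is an upper bound for the operator norm of \<open>N k\<close>
    minus the identity with respect to \<open>cnorm\<close>.\<close>
  define e where "e = (\<lambda>k. \<Sum>b\<in>Basis. cnorm (N k b - b))"
  have "e \<longlonglongrightarrow> (\<Sum>b\<in>Basis. 0)"
    unfolding e_def using N by (intro tendsto_sum) (simp add: wlim_cnorm)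
  then have "eventually (\<lambda>k. e k < 1/2) sequentially"
    by (intro order_tendstoD) auto
  then show ?thesis
  proof (rule eventually_mono, intro allI)
    fix k z assume k: "e k < 1/2"
    have "z - N k z = (\<Sum>b\<in>Basis. scale (coord b z) (b - N k b))"
      using V_linear_expand[OF lin[of k], of z] sum_coord[of z]
      by (simp add: scale_right_diff_distrib sum_subtractf)
    then have "cnorm (z - N k z) \<le> (\<Sum>b\<in>Basis. cmod (coord b z) * cnorm (b - N k b))"
      using cnorm_sum[of "\<lambda>b. scale (coord b z) (b - N k b)" Basis] by (simp add: cnorm_scale)
    also have "\<dots> \<le> (\<Sum>b\<in>Basis. cmod (coord b z) * e k)"
    proof (intro sum_mono mult_left_mono)
      fix b assume b: "b \<in> Basis"
      have "cnorm (b - N k b) = cnorm (N k b - b)"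
        using cnorm_scale[of "-1" "N k b - b"] by simp
      also have "\<dots> \<le> e k"
        unfolding e_def using b finite_Basis by (intro member_le_sum) (auto simp: cnorm_nonneg)
      finally show "cnorm (b - N k b) \<le> e k" .
    qed auto
    also have "\<dots> = e k * cnorm z"
      by (simp add: cnorm_def sum_distrib_left mult.commute)
    also have "\<dots> \<le> 1/2 * cnorm z"
      using k cnorm_nonneg by (intro mult_right_mono) auto
    finally have "cnorm (z - N k z) \<le> 1/2 * cnorm z" .
    moreover have "cnorm z \<le> cnorm (z - N k z) + cnorm (N k z)"
      using cnorm_add[of "z - N k z" "N k z"] by simp
    ultimately show "cnorm z \<le> 2 * cnorm (N k z)" by linarith
  qed
qed

lemma near_identity_inj:
  assumes "\<And>k. V_linear (N k)" "\<And>x. wlim (\<lambda>k. N k x) x"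
  shows "eventually (\<lambda>k. inj (N k)) sequentially"
  using near_identity[OF assms]
proof (rule eventually_mono)
  fix k assume "\<forall>z. cnorm z \<le> 2 * cnorm (N k z)"
  then show "inj (N k)"
    by (intro V_linear_inj assms(1) cnorm_eq_0)
      (metis cnorm_nonneg cnorm_zero mult_zero_right order_antisym)
qed

text \<open>The uniform bound of \<open>near_identity\<close>, applied to \<open>z k - y\<close>,
  plays the part of a bounded inverse. It serves to cancel \<open>Q k\<close> and similar operators
  from a limit.\<close>

lemma near_identity_preimage:
  assumes lin: "\<And>k. V_linear (N k)" and N: "\<And>x. wlim (\<lambda>k. N k x) x"
    and z: "wlim (\<lambda>k. N k (z k)) y"
  shows "wlim z y"
proof -
  have "wlim (\<lambda>k. N k (z k) - N k y) (y - y)"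
    by (rule wlim_diff[OF z N])
  then have "(\<lambda>k. cnorm (N k (z k - y))) \<longlonglongrightarrow> 0"
    by (simp add: wlim_cnorm V_linear_diff[OF lin])
  moreover have "eventually (\<lambda>k. norm (cnorm (z k - y)) \<le> norm (cnorm (N k (z k - y))) * 2) sequentially"
    using near_identity[OF lin N] by (rule eventually_mono) (simp add: cnorm_nonneg mult.commute)
  ultimately show ?thesis
    unfolding wlim_cnorm by (rule tendsto_0_le)
qed

end


section \<open>Tensors\<close>

context complex_fd
begin

lemma dual_args_iff: "\<alpha>s \<in> dual_args scale d \<longleftrightarrow> length \<alpha>s = d \<and> set \<alpha>s \<subseteq> V_dual"
  by (simp add: dual_args_def)

lemma tensor_lincomb:
  assumes "is_tensor scale d T" "\<alpha>s \<in> dual_args scale d" "i < d" "\<beta> \<in> V_dual" "\<gamma> \<in> V_dual"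
  shows "T (\<alpha>s[i := (\<lambda>v. b * \<beta> v + c * \<gamma> v)]) = b * T (\<alpha>s[i := \<beta>]) + c * T (\<alpha>s[i := \<gamma>])"
  using assms unfolding is_tensor_def by blast

lemma tensor_expand:
  assumes T: "is_tensor scale d T" and \<alpha>s: "\<alpha>s \<in> dual_args scale d" and i: "i < d"
    and \<beta>: "\<beta> \<in> V_dual"
  shows "T (\<alpha>s[i := \<beta>]) = (\<Sum>b\<in>Basis. \<beta> b * T (\<alpha>s[i := coord b]))"
proof -
  have *: "T (\<alpha>s[i := (\<lambda>v. \<Sum>b\<in>S. \<beta> b * coord b v)]) = (\<Sum>b\<in>S. \<beta> b * T (\<alpha>s[i := coord b]))"
    if "finite S" for S
    using that
  proof induction
    case empty
    then show ?case
      \<comment> \<open>Coefficients 0 and 0 produce the zero functional, on which the form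
        therefore vanishes.\<close>
      using tensor_lincomb[OF T \<alpha>s i \<beta> \<beta>, of 0 0] by simp
  next
    case (insert b S)
    have "T (\<alpha>s[i := (\<lambda>v. \<beta> b * coord b v + 1 * (\<Sum>b\<in>S. \<beta> b * coord b v))])
        = \<beta> b * T (\<alpha>s[i := coord b]) + 1 * T (\<alpha>s[i := (\<lambda>v. \<Sum>b\<in>S. \<beta> b * coord b v)])"
      by (intro tensor_lincomb[OF T \<alpha>s i] coord_dual sum_dual dual_scaled)
    then show ?case using insert by simp
  qed
  have "(\<lambda>v. \<Sum>b\<in>Basis. \<beta> b * coord b v) = \<beta>"
    by (rule ext) (rule dual_expand[OF \<beta>, symmetric])
  then show ?thesis using *[OF finite_Basis] by (simp only:)
qed

text \<open>Expanding the first argument in the coordinate functionals reduces \<open>d + 1\<close>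
  to \<open>d\<close>; for \<open>d = 1\<close> the form is evaluation at a vector \<open>w\<close>.
  At \<open>d = 0\<close> the empty product makes every decomposable tensor equal to 1, hence the
  start at 1.\<close>

lemma tensor_finite_rank:
  assumes "d > 0" "is_tensor scale d T"
  shows "\<exists>Ds. (\<forall>D\<in>set Ds. is_decomposable scale d D) \<and>
    (\<forall>\<alpha>s\<in>dual_args scale d. T \<alpha>s = (\<Sum>D\<leftarrow>Ds. D \<alpha>s))"
  using assms
proof (induction d arbitrary: T rule: nat_induct_non_zero)
  case 1
  define w where "w = (\<Sum>b\<in>Basis. scale (T [coord b]) b)"
  have "T \<alpha>s = (\<Prod>i<1. (\<alpha>s ! i) w)" if \<alpha>s: "\<alpha>s \<in> dual_args scale 1" for \<alpha>s
  proof -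
    obtain \<alpha> where \<alpha>: "\<alpha>s = [\<alpha>]" "\<alpha> \<in> V_dual"
      using \<alpha>s by (cases \<alpha>s) (auto simp: dual_args_iff)
    have "\<alpha> w = (\<Sum>b\<in>Basis. T [coord b] * \<alpha> b)"
      unfolding w_def by (simp only: dual_sum[OF \<alpha>(2)] dual_scale[OF \<alpha>(2)])
    then show ?thesis
      using tensor_expand[OF 1 \<alpha>s, of 0 \<alpha>] \<alpha> by (simp add: mult.commute)
  qed
  then have "is_decomposable scale 1 T"
    unfolding is_decomposable_def by (intro exI[of _ "\<lambda>_. w"]) auto
  then show ?case by (intro exI[of _ "[T]"]) simp
next
  case (Suc d)
  have "is_tensor scale d (\<lambda>\<alpha>s. T (coord b # \<alpha>s))" for b
    unfolding is_tensor_def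
  proof (intro ballI allI impI)
    fix \<alpha>s i \<beta> \<gamma> p q
    assume "\<alpha>s \<in> dual_args scale d" "i < d" "\<beta> \<in> V_dual" "\<gamma> \<in> V_dual"
    then show "T (coord b # \<alpha>s[i := (\<lambda>v. p * \<beta> v + q * \<gamma> v)])
        = p * T (coord b # \<alpha>s[i := \<beta>]) + q * T (coord b # \<alpha>s[i := \<gamma>])"
      using tensor_lincomb[OF Suc.prems, of "coord b # \<alpha>s" "Suc i" \<beta> \<gamma> p q]
      by (simp add: dual_args_iff coord_dual)
  qed
  then have "\<forall>b. \<exists>Ds. (\<forall>D\<in>set Ds. is_decomposable scale d D) \<and>
      (\<forall>\<alpha>s\<in>dual_args scale d. T (coord b # \<alpha>s) = (\<Sum>D\<leftarrow>Ds. D \<alpha>s))"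
    using Suc.IH by blast
  then obtain Ds where Ds: "\<And>b D. D \<in> set (Ds b) \<Longrightarrow> is_decomposable scale d D"
      "\<And>b \<alpha>s. \<alpha>s \<in> dual_args scale d \<Longrightarrow> T (coord b # \<alpha>s) = (\<Sum>D\<leftarrow>Ds b. D \<alpha>s)"
    by metis
  \<comment> \<open>\<open>E b D\<close> is the tensor product of \<open>b\<close>, as a new first
    factor, with \<open>D\<close>; on the level of factors this is
    \<open>case_nat b v\<close>.\<close>
  define E :: "'v \<Rightarrow> 'v tensor \<Rightarrow> 'v tensor" where "E = (\<lambda>b D \<alpha>s. hd \<alpha>s b * D (tl \<alpha>s))"
  obtain bs where bs: "set bs = Basis" "distinct bs"
    using finite_distinct_list[OF finite_Basis] by blast
  have E: "is_decomposable scale (Suc d) (E b D)" if D: "D \<in> set (Ds b)" for b D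
  proof -
    obtain v where v: "\<And>\<alpha>s. \<alpha>s \<in> dual_args scale d \<Longrightarrow> D \<alpha>s = (\<Prod>i<d. (\<alpha>s ! i) (v i))"
      using Ds(1)[OF D] unfolding is_decomposable_def by blast
    have "E b D \<alpha>s = (\<Prod>i<Suc d. (\<alpha>s ! i) (case_nat b v i))"
      if \<alpha>s: "\<alpha>s \<in> dual_args scale (Suc d)" for \<alpha>s
    proof -
      obtain \<alpha> \<alpha>s' where \<alpha>: "\<alpha>s = \<alpha> # \<alpha>s'" "\<alpha>s' \<in> dual_args scale d"
        using \<alpha>s by (auto simp: dual_args_iff length_Suc_conv)
      then show ?thesis
        unfolding prod.lessThan_Suc_shift by (simp add: E_def v)
    qed
    then show ?thesis unfolding is_decomposable_def by blast
  qed
  have "T \<alpha>s = (\<Sum>D\<leftarrow>concat (map (\<lambda>b. map (E b) (Ds b)) bs). D \<alpha>s)"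
    if \<alpha>s: "\<alpha>s \<in> dual_args scale (Suc d)" for \<alpha>s
  proof -
    obtain \<alpha> \<alpha>s' where \<alpha>: "\<alpha>s = \<alpha> # \<alpha>s'" "\<alpha> \<in> V_dual" "\<alpha>s' \<in> dual_args scale d"
      using \<alpha>s by (auto simp: dual_args_iff length_Suc_conv)
    have "T \<alpha>s = (\<Sum>b\<in>Basis. \<alpha> b * T (coord b # \<alpha>s'))"
      using tensor_expand[OF Suc.prems \<alpha>s, of 0 \<alpha>] \<alpha> by simp
    also have "\<dots> = (\<Sum>b\<leftarrow>bs. \<alpha> b * T (coord b # \<alpha>s'))"
      by (simp only: sum.distinct_set_conv_list[OF bs(2), unfolded bs(1)])
    also have "\<dots> = (\<Sum>D\<leftarrow>concat (map (\<lambda>b. map (E b) (Ds b)) bs). D \<alpha>s)"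
      unfolding Ds(2)[OF \<alpha>(3)]
      by (induction bs) (simp_all add: E_def \<alpha>(1) o_def sum_list_const_mult)
    finally show ?thesis .
  qed
  then show ?case
    using E by (intro exI[of _ "concat (map (\<lambda>b. map (E b) (Ds b)) bs)"]) auto
qed

text \<open>The \<open>LEAST\<close> in \<open>border_rank\<close> is attained because some rank is
  admissible: a finite decomposition of \<open>T\<close> gives a constant approximating
  sequence.\<close>

lemma limit_of_rank_border_rank:
  assumes "d > 0" "is_tensor scale d T"
  shows "is_limit_of_rank scale d T (border_rank scale d T)"
proof -
  obtain Ds where Ds: "\<And>D. D \<in> set Ds \<Longrightarrow> is_decomposable scale d D"
      "\<And>\<alpha>s. \<alpha>s \<in> dual_args scale d \<Longrightarrow> T \<alpha>s = (\<Sum>D\<leftarrow>Ds. D \<alpha>s)"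
    using tensor_finite_rank[OF assms] by blast
  have "(\<Sum>j<length Ds. (Ds ! j) \<alpha>s) = (\<Sum>D\<leftarrow>Ds. D \<alpha>s)" for \<alpha>s
    by (simp add: sum_list_sum_nth atLeast0LessThan)
  then have "is_limit_of_rank scale d T (length Ds)"
    unfolding is_limit_of_rank_def using Ds by (intro exI[of _ "\<lambda>_ j. Ds ! j"]) auto
  then show ?thesis unfolding border_rank_def by (rule LeastI)
qed

text \<open>Reduces every later rearrangement of arguments to an equality of multisets, with no
  explicit permutation.\<close>

lemma symmetric_tensor_mset:
  assumes T: "is_symmetric_tensor scale d T" and \<alpha>s: "\<alpha>s \<in> dual_args scale d"
    and m: "mset \<beta>s = mset \<alpha>s"
  shows "T \<beta>s = T \<alpha>s"
proof -
  obtain p where p: "p permutes {..<length \<alpha>s}" "permute_list p \<alpha>s = \<beta>s"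
    using mset_eq_permutation[OF m] by blast
  then have "p permutes {..<d}" using \<alpha>s by (simp add: dual_args_iff)
  then show ?thesis using T \<alpha>s p(2) unfolding is_symmetric_tensor_def by blast
qed

end


section \<open>Finite-dimensional commutative algebras\<close>

locale complex_algebra = complex_fd scale Basis
  for scale :: "complex \<Rightarrow> 'v::ab_group_add \<Rightarrow> 'v" and Basis :: "'v set" +
  fixes mul :: "'v \<Rightarrow> 'v \<Rightarrow> 'v" (infixl "\<star>" 70) and u :: 'v
  assumes mul_assoc: "(x \<star> y) \<star> z = x \<star> (y \<star> z)"
    and mul_comm: "x \<star> y = y \<star> x"
    and mul_unit: "u \<star> x = x"
    and mul_add: "(x + y) \<star> z = x \<star> z + y \<star> z"
    and mul_scale: "scale c x \<star> y = scale c (x \<star> y)"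
begin

lemma mul_add2: "z \<star> (x + y) = z \<star> x + z \<star> y"
  by (metis mul_add mul_comm)

lemma mul_scale2: "y \<star> scale c x = scale c (y \<star> x)"
  by (metis mul_scale mul_comm)

lemma mul_unit2: "x \<star> u = x"
  by (metis mul_unit mul_comm)

lemma mul_left_comm: "x \<star> (y \<star> z) = y \<star> (x \<star> z)"
  by (metis mul_assoc mul_comm)

lemma V_linear_mul: "V_linear ((\<star>) x)"
  by (rule linearI_V) (simp_all add: mul_add2 mul_scale2)

lemma mul_zero2: "x \<star> 0 = 0"
  by (rule V_linear_zero[OF V_linear_mul])

lemma mul_zero: "0 \<star> x = 0"
  by (metis mul_zero2 mul_comm)

lemma mul_diff2: "x \<star> (y - z) = x \<star> y - x \<star> z"
  by (rule V_linear_diff[OF V_linear_mul])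

lemma cring_alg_ring: "cring (alg_ring (\<star>) u)"
proof (rule cringI)
  show "abelian_group (alg_ring (\<star>) u)"
    by (rule abelian_groupI)
      (auto simp: alg_ring_def algebra_simps intro: exI[of _ "- x" for x])
  show "Group.comm_monoid (alg_ring (\<star>) u)"
    by (rule comm_monoidI)
      (auto simp: alg_ring_def mul_assoc mul_unit intro: mul_comm)
qed (auto simp: alg_ring_def mul_add)

lemma is_algebra_mul: "is_algebra scale (\<star>) u"
  unfolding is_algebra_def
  using finite_dimensional_vector_space_axioms cring_alg_ring mul_scale by blast

section \<open>Evaluation of polynomials by Horner's scheme, and annihilating polynomials\<close>

definition poly_eval :: "'v \<Rightarrow> complex poly \<Rightarrow> 'v" where
  "poly_eval a p = fold_coeffs (\<lambda>c y. scale c u + a \<star> y) p 0"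

lemma poly_eval_0: "poly_eval a 0 = 0"
  by (simp add: poly_eval_def)

lemma poly_eval_pCons: "poly_eval a (pCons c p) = scale c u + a \<star> poly_eval a p"
  by (cases "c = 0 \<and> p = 0") (auto simp: poly_eval_def mul_zero2)

lemma poly_eval_add: "poly_eval a (p + q) = poly_eval a p + poly_eval a q"
  by (induction p q rule: poly_induct2)
    (simp_all add: poly_eval_0 poly_eval_pCons scale_left_distrib mul_add2)

lemma poly_eval_smult: "poly_eval a (smult c p) = scale c (poly_eval a p)"
  by (induction p) (simp_all add: poly_eval_0 poly_eval_pCons scale_right_distrib mul_scale2)

lemma poly_eval_sum: "poly_eval a (\<Sum>i\<in>I. h i) = (\<Sum>i\<in>I. poly_eval a (h i))"
  by (induction I rule: infinite_finite_induct) (simp_all add: poly_eval_0 poly_eval_add)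

lemma poly_eval_monom: "poly_eval a (monom c i) = scale c (((\<star>) a ^^ i) u)"
  by (induction i) (simp_all add: monom_0 monom_Suc poly_eval_pCons poly_eval_0 mul_zero2 mul_scale2)

lemma poly_eval_root: "poly_eval a ([:- r, 1:] * q) = (a - scale r u) \<star> poly_eval a q"
proof -
  have "[:- r, 1:] * q = smult (- r) q + pCons 0 q" by simp
  then have "poly_eval a ([:- r, 1:] * q) = a \<star> poly_eval a q - scale r (poly_eval a q)"
    by (simp only: poly_eval_add poly_eval_smult poly_eval_pCons) simp
  also have "\<dots> = (a - scale r u) \<star> poly_eval a q"
    by (simp add: mul_comm[of _ "poly_eval a q"] mul_diff2 mul_scale2 mul_unit2)
  finally show ?thesis .
qed

text \<open>The powers of \<open>a\<close> with exponents \<open>0\<close> to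
  \<open>card Basis\<close> are too many to be independent. A coincidence of two powers is split
  off, since the set of powers would not record it; it gives a difference of two monomials.\<close>

lemma annihilating_poly: "\<exists>p. p \<noteq> 0 \<and> poly_eval a p = 0"
proof (cases "inj_on (\<lambda>i. ((\<star>) a ^^ i) u) {..card Basis}")
  case False
  then obtain i j where ij: "i \<noteq> j" "((\<star>) a ^^ i) u = ((\<star>) a ^^ j) u"
    by (auto simp: inj_on_def)
  have "coeff (monom 1 i + monom (- 1) j :: complex poly) i = 1" using ij by simp
  then have "monom 1 i + monom (- 1) j \<noteq> (0 :: complex poly)" by fastforce
  then show ?thesis using ij
    by (intro exI[of _ "monom 1 i + monom (- 1) j"]) (simp add: poly_eval_add poly_eval_monom)
next
  case True
  let ?S = "(\<lambda>i. ((\<star>) a ^^ i) u) ` {..card Basis}"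
  have "card ?S = Suc (card Basis)" using True by (simp add: card_image)
  then have "dependent ?S"
    using independent_card_le_dim[of ?S UNIV] by auto
  then obtain c v where c: "v \<in> ?S" "c v \<noteq> 0" "(\<Sum>v\<in>?S. scale (c v) v) = 0"
    using dependent_finite[of ?S] by auto
  define p where "p = (\<Sum>i\<le>card Basis. monom (c (((\<star>) a ^^ i) u)) i)"
  have "poly_eval a p = 0"
    using c(3) True unfolding p_def by (simp add: poly_eval_sum poly_eval_monom sum.reindex)
  moreover obtain i where i: "i \<le> card Basis" "v = ((\<star>) a ^^ i) u" using c(1) by auto
  have "coeff p i = c v"
    using i by (simp add: p_def coeff_sum)
  then have "p \<noteq> 0" using c(2) by auto
  ultimately show ?thesis by blast
qed

end

section \<open>Residues and localization at a prime ideal\<close>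

locale prime_of_algebra = complex_algebra scale Basis mul u
  for scale :: "complex \<Rightarrow> 'v::ab_group_add \<Rightarrow> 'v" and Basis :: "'v set"
    and mul (infixl "\<star>" 70) and u +
  fixes \<mm> :: "'v set"
  assumes prime: "primeideal \<mm> (alg_ring (\<star>) u)"
begin

lemma prime_add: "x \<in> \<mm> \<Longrightarrow> y \<in> \<mm> \<Longrightarrow> x + y \<in> \<mm>"
  using additive_subgroup.a_closed[OF ideal.axioms(1)[OF primeideal.axioms(1)[OF prime]]]
  by (simp add: alg_ring_def)

lemma prime_mul: "x \<in> \<mm> \<Longrightarrow> y \<star> x \<in> \<mm>"
  using ideal.I_l_closed[OF primeideal.axioms(1)[OF prime]] by (simp add: alg_ring_def)

lemma prime_mul1: "x \<in> \<mm> \<Longrightarrow> x \<star> y \<in> \<mm>"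
  by (metis prime_mul mul_comm)

lemma prime_cases: "x \<star> y \<in> \<mm> \<Longrightarrow> x \<in> \<mm> \<or> y \<in> \<mm>"
  using primeideal.I_prime[OF prime] by (simp add: alg_ring_def)

lemma unit_notin: "u \<notin> \<mm>"
  using ideal.one_imp_carrier[OF primeideal.axioms(1)[OF prime]] primeideal.I_notcarr[OF prime]
  by (auto simp: alg_ring_def)

lemma mul_notin: "x \<notin> \<mm> \<Longrightarrow> y \<notin> \<mm> \<Longrightarrow> x \<star> y \<notin> \<mm>"
  using prime_cases by blast

lemma prime_scale: "x \<in> \<mm> \<Longrightarrow> scale c x \<in> \<mm>"
  using prime_mul[of x "scale c u"] by (simp add: mul_scale mul_unit)

lemma prime_zero: "0 \<in> \<mm>"
  using additive_subgroup.zero_closed[OF ideal.axioms(1)[OF primeideal.axioms(1)[OF prime]]]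
  by (simp add: alg_ring_def)

lemma prime_diff: "x \<in> \<mm> \<Longrightarrow> y \<in> \<mm> \<Longrightarrow> x - y \<in> \<mm>"
  using prime_add[of x "scale (- 1) y"] prime_scale[of y "- 1"] by simp

text \<open>Take a nonzero polynomial of least degree whose value at \<open>a\<close> lies in
  \<open>\<mm>\<close>. It is not constant, as \<open>u\<close> is outside \<open>\<mm>\<close>, so
  it has a complex root \<open>r\<close>. The cofactor of \<open>[:- r, 1:]\<close> has smaller
  degree, so its value lies outside \<open>\<mm>\<close>, and primality leaves
  \<open>a - scale r u\<close> inside.\<close>

lemma residue_exists: "\<exists>r. a - scale r u \<in> \<mm>"
proof -
  define Q where "Q = (\<lambda>p. p \<noteq> 0 \<and> poly_eval a p \<in> \<mm>)"
  have "\<exists>p. Q p"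
    using annihilating_poly[of a] prime_zero unfolding Q_def by metis
  then obtain p where p: "Q p" and min: "\<And>q. Q q \<Longrightarrow> degree p \<le> degree q"
    using exists_least_iff[of "\<lambda>n. \<exists>p. Q p \<and> degree p = n"] by (metis not_le)
  have "\<not> (\<exists>c l. c \<noteq> 0 \<and> l = 0 \<and> p = pCons c l)"
  proof safe
    fix c assume c: "p = [:c:]" "c \<noteq> 0"
    then have "scale c u \<in> \<mm>" using p by (simp add: Q_def poly_eval_pCons poly_eval_0 mul_zero2)
    then have "scale (1 / c) (scale c u) \<in> \<mm>" by (rule prime_scale)
    then show False using c unit_notin by simp
  qed
  then obtain r where "poly p r = 0" using fundamental_theorem_of_algebra_alt by blast
  then obtain q where q: "p = [:- r, 1:] * q" using poly_eq_0_iff_dvd by (metis dvdE)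
  have "q \<noteq> 0" using p q by (auto simp: Q_def)
  then have "degree p = Suc (degree q)"
    unfolding q by (subst degree_mult_eq) auto
  then have "\<not> Q q" using min[of q] by auto
  then have "poly_eval a q \<notin> \<mm>" using \<open>q \<noteq> 0\<close> by (simp add: Q_def)
  moreover have "(a - scale r u) \<star> poly_eval a q \<in> \<mm>"
    using p unfolding Q_def q poly_eval_root by simp
  ultimately show ?thesis using prime_cases by blast
qed

lemma residue_unique: "a - scale r u \<in> \<mm> \<Longrightarrow> a - scale s u \<in> \<mm> \<Longrightarrow> r = s"
proof (rule ccontr)
  assume "a - scale r u \<in> \<mm>" "a - scale s u \<in> \<mm>" and rs: "r \<noteq> s"
  then have "(a - scale r u) - (a - scale s u) \<in> \<mm>" by (simp only: prime_diff)
  then have "scale (s - r) u \<in> \<mm>" by (simp add: scale_left_diff_distrib)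
  then have "scale (1 / (s - r)) (scale (s - r) u) \<in> \<mm>" by (rule prime_scale)
  then show False using rs unit_notin by simp
qed

text \<open>The quotient map to \<open>A/\<mm>\<close>, identified with the complex numbers through
  the unit.\<close>

definition residue :: "'v \<Rightarrow> complex" where
  "residue a = (THE r. a - scale r u \<in> \<mm>)"

lemma residue_eqI: "a - scale r u \<in> \<mm> \<Longrightarrow> residue a = r"
  unfolding residue_def using residue_unique by blast

lemma residue: "a - scale (residue a) u \<in> \<mm>"
  using residue_exists residue_eqI by blast

lemma residue_eq_0: "residue a = 0 \<longleftrightarrow> a \<in> \<mm>"
  using residue[of a] residue_eqI[of a 0] by auto

lemma residue_unit: "residue u = 1"
  by (rule residue_eqI) (simp add: prime_zero)

lemma residue_dual: "residue \<in> V_dual"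
proof (rule dualI; rule residue_eqI)
  fix x y c
  have "(x - scale (residue x) u) + (y - scale (residue y) u) \<in> \<mm>"
    by (intro prime_add residue)
  then show "(x + y) - scale (residue x + residue y) u \<in> \<mm>"
    by (simp add: scale_left_distrib algebra_simps)
  show "scale c x - scale (c * residue x) u \<in> \<mm>"
    using prime_scale[OF residue[of x], of c] by (simp add: scale_right_diff_distrib)
qed

text \<open>Classes are sets of pairs, so passing from the relation to their equality needs
  transitivity. The multiplier that achieves it is the product of \<open>r'\<close>,
  \<open>r\<close> and \<open>s\<close>, which primality keeps outside \<open>\<mm>\<close>.\<close>

lemma loc_frac_eq_iff:
  assumes "s \<notin> \<mm>" "t \<notin> \<mm>"
  shows "loc_frac (\<star>) \<mm> a s = loc_frac (\<star>) \<mm> b t \<longleftrightarrow> (\<exists>r. r \<notin> \<mm> \<and> r \<star> (t \<star> a - s \<star> b) = 0)"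
proof
  assume eq: "loc_frac (\<star>) \<mm> a s = loc_frac (\<star>) \<mm> b t"
  have "(b, t) \<in> loc_frac (\<star>) \<mm> b t"
    using assms unit_notin by (auto simp: loc_frac_def loc_rel_def mul_unit intro!: exI[of _ u])
  then show "\<exists>r. r \<notin> \<mm> \<and> r \<star> (t \<star> a - s \<star> b) = 0"
    unfolding eq[symmetric] by (auto simp: loc_frac_def loc_rel_def)
next
  assume "\<exists>r. r \<notin> \<mm> \<and> r \<star> (t \<star> a - s \<star> b) = 0"
  then obtain r where r: "r \<notin> \<mm>" "r \<star> (t \<star> a) = r \<star> (s \<star> b)"
    by (auto simp: mul_diff2)
  have *: "\<exists>r. r \<notin> \<mm> \<and> r \<star> (t' \<star> b - t \<star> x) = 0"
    if rs: "r \<notin> \<mm>" "s \<notin> \<mm>" and ab: "r \<star> (t \<star> a) = r \<star> (s \<star> b)"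
      and r': "r' \<notin> \<mm>" "r' \<star> (t' \<star> a - s \<star> x) = 0" for r r' s t t' a b x
  proof -
    have "r' \<star> (r \<star> (s \<star> (t' \<star> b))) = r' \<star> (t' \<star> (r \<star> (s \<star> b)))"
      by (simp add: mul_left_comm)
    also have "\<dots> = r \<star> (t \<star> (r' \<star> (t' \<star> a)))"
      unfolding ab[symmetric] by (simp add: mul_left_comm)
    also have "\<dots> = r \<star> (t \<star> (r' \<star> (s \<star> x)))"
      using r'(2) by (simp add: mul_diff2)
    also have "\<dots> = r' \<star> (r \<star> (s \<star> (t \<star> x)))"
      by (simp add: mul_left_comm)
    finally have "(r' \<star> (r \<star> s)) \<star> (t' \<star> b - t \<star> x) = 0"
      by (simp add: mul_diff2 mul_assoc)
    moreover have "r' \<star> (r \<star> s) \<notin> \<mm>"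
      by (intro mul_notin rs r')
    ultimately show ?thesis by (intro exI conjI)
  qed
  have "(\<exists>r. r \<notin> \<mm> \<and> r \<star> (t' \<star> a - s \<star> x) = 0) \<longleftrightarrow>
      (\<exists>r. r \<notin> \<mm> \<and> r \<star> (t' \<star> b - t \<star> x) = 0)" for x t'
    using *[OF r(1) assms(1) r(2)] *[OF r(1) assms(2) r(2)[symmetric]] by (intro iffI; elim exE conjE)
  then show "loc_frac (\<star>) \<mm> a s = loc_frac (\<star>) \<mm> b t"
    using assms by (auto simp: loc_frac_def loc_rel_def)
qed

lemma loc_frac_zero_iff:
  assumes "s \<notin> \<mm>"
  shows "loc_frac (\<star>) \<mm> a s = loc_frac (\<star>) \<mm> 0 u \<longleftrightarrow> (\<exists>r. r \<notin> \<mm> \<and> r \<star> a = 0)"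
  using loc_frac_eq_iff[OF assms unit_notin] by (simp add: mul_unit mul_zero2)

text \<open>The product of the individual annihilators works, and primality keeps it outside
  \<open>\<mm>\<close>.\<close>

lemma common_annihilator:
  assumes "finite F" "\<And>f. f \<in> F \<Longrightarrow> \<exists>r. r \<notin> \<mm> \<and> r \<star> f = 0"
  shows "\<exists>r. r \<notin> \<mm> \<and> (\<forall>f\<in>F. r \<star> f = 0)"
  using assms
proof (induction rule: finite_induct)
  case empty
  then show ?case using unit_notin by blast
next
  case (insert f F)
  then obtain r r' where r: "r \<notin> \<mm>" "\<forall>f\<in>F. r \<star> f = 0" "r' \<notin> \<mm>" "r' \<star> f = 0"
    by (metis insertCI)
  have "r' \<star> r \<star> g = 0" if "g \<in> insert f F" for g
    using r that by (cases "g = f") (auto simp: mul_assoc mul_zero2 mul_left_comm[of r' r])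
  then show ?case using mul_notin[OF r(3,1)] by blast
qed

text \<open>
  \<open>z\<close> represents the functional \<open>A \<rightarrow> A/\<mm> = \<complex>\<close> with respect to the pairing, so it spans \<open>(0 : \<mm>)\<close>.
  As \<open>\<complex> u + \<mm> = A\<close>, its image in the localization is nonzero and spans the socle.
\<close>

lemma localization_socle_line:
  assumes e: "e \<in> V_dual" and repr: "\<And>\<chi>. \<chi> \<in> V_dual \<Longrightarrow> \<exists>z. \<forall>a. \<chi> a = e (z \<star> a)"
  shows "\<exists>a s. s \<notin> \<mm> \<and> loc_frac (\<star>) \<mm> a s \<noteq> loc_frac (\<star>) \<mm> 0 u \<and>
    loc_socle (\<star>) u \<mm> = {loc_frac (\<star>) \<mm> (scale c a) s | c. True}"
proof -
  \<comment> \<open>Every functional is \<open>e (z \<star> a)\<close> in \<open>a\<close>, so an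
    \<open>x\<close> that pairs to zero with everything is killed by all functionals.\<close>
  have nondeg: "x = 0" if "\<And>a. e (x \<star> a) = 0" for x
  proof (rule dual_eqI)
    fix \<chi> assume "\<chi> \<in> V_dual"
    then obtain z where z: "\<And>a. \<chi> a = e (z \<star> a)" using repr by blast
    then show "\<chi> x = \<chi> 0" using that[of z] by (simp add: mul_comm[of z] mul_zero dual_zero[OF e])
  qed
  obtain z where z: "\<And>a. residue a = e (z \<star> a)" using repr[OF residue_dual] by blast
  have z_ann: "\<mu> \<star> z = 0" if "\<mu> \<in> \<mm>" for \<mu>
  proof (rule nondeg)
    fix a
    have "e (\<mu> \<star> z \<star> a) = residue (\<mu> \<star> a)"
      by (simp add: z mul_assoc mul_left_comm)
    then show "e (\<mu> \<star> z \<star> a) = 0" using prime_mul1[OF that] residue_eq_0 by simp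
  qed
  \<comment> \<open>Modulo \<open>\<mm>\<close>, which kills \<open>z\<close>, the element
    \<open>a\<close> is the scalar \<open>residue a\<close>.\<close>
  have z_act: "a \<star> z = scale (residue a) z" for a
    using z_ann[OF residue[of a]]
    by (metis eq_iff_diff_eq_0 mul_comm mul_diff2 mul_scale2 mul_unit2)
  have "z \<noteq> 0" using z[of u] residue_unit by (auto simp: mul_zero dual_zero[OF e])
  then have z_loc: "r \<star> z \<noteq> 0" if "r \<notin> \<mm>" for r
    using that by (simp add: z_act residue_eq_0)
  have line: "\<exists>c. x = scale c z" if x: "\<And>\<mu>. \<mu> \<in> \<mm> \<Longrightarrow> \<mu> \<star> x = 0" for x
  proof -
    have x_act: "a \<star> x = scale (residue a) x" for a
      using x[OF residue[of a]]
      by (metis eq_iff_diff_eq_0 mul_comm mul_diff2 mul_scale2 mul_unit2)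
    \<comment> \<open>The coefficient is \<open>e x\<close> because
      \<open>e z = residue u = 1\<close>; the difference then pairs to zero with every
      \<open>a\<close>.\<close>
    have "x - scale (e x) z = 0"
    proof (rule nondeg)
      fix a
      have "(x - scale (e x) z) \<star> a = scale (residue a) (x - scale (e x) z)"
        by (simp add: mul_comm[of _ a] mul_diff2 x_act mul_scale2 z_act scale_right_diff_distrib
            mult.commute)
      moreover have "e z = 1" using z[of u] residue_unit by (simp add: mul_unit2)
      ultimately show "e ((x - scale (e x) z) \<star> a) = 0"
        by (simp add: dual_scale[OF e] dual_diff[OF e])
    qed
    then show ?thesis by auto
  qed
  have "loc_socle (\<star>) u \<mm> = {loc_frac (\<star>) \<mm> (scale c z) u | c. True}"
  proof (intro equalityI subsetI)
    fix y assume "y \<in> loc_socle (\<star>) u \<mm>"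
    then obtain a s where y: "y = loc_frac (\<star>) \<mm> a s" "s \<notin> \<mm>"
      and soc: "\<And>\<mu> t. \<mu> \<in> \<mm> \<Longrightarrow> t \<notin> \<mm> \<Longrightarrow>
        loc_frac (\<star>) \<mm> (\<mu> \<star> a) (t \<star> s) = loc_frac (\<star>) \<mm> 0 u"
      unfolding loc_socle_def by blast
    have ann: "\<exists>r. r \<notin> \<mm> \<and> r \<star> (\<mu> \<star> a) = 0" if "\<mu> \<in> \<mm>" for \<mu>
      using soc[OF that unit_notin] loc_frac_zero_iff[OF mul_notin[OF unit_notin y(2)]] by blast
    \<comment> \<open>Membership in the socle says only that each \<open>\<mu> \<star> a\<close>
      dies after some multiplier. The elements \<open>b - scale (residue b) u\<close> span
      \<open>\<mm>\<close>, so a common multiplier \<open>r\<close> for these finitely many makes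
      \<open>r \<star> a\<close> annihilated by all of \<open>\<mm>\<close>.\<close>
    define F where "F = (\<lambda>b. (b - scale (residue b) u) \<star> a) ` Basis"
    have "\<exists>r. r \<notin> \<mm> \<and> (\<forall>f\<in>F. r \<star> f = 0)"
      by (rule common_annihilator) (auto simp: F_def finite_Basis intro: ann residue)
    then obtain r where r: "r \<notin> \<mm>" "\<And>b. b \<in> Basis \<Longrightarrow> r \<star> ((b - scale (residue b) u) \<star> a) = 0"
      by (auto simp: F_def)
    have "\<mu> \<star> (r \<star> a) = 0" if \<mu>: "\<mu> \<in> \<mm>" for \<mu>
    proof -
      have rb: "b \<star> (r \<star> a) = scale (residue b) (r \<star> a)" if "b \<in> Basis" for b
      proof -
        have "(b - scale (residue b) u) \<star> a = b \<star> a - scale (residue b) a"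
          by (metis mul_comm mul_diff2 mul_scale2 mul_unit2)
        then show ?thesis
          using r(2)[OF that] by (simp add: mul_diff2 mul_scale2 mul_left_comm[of b])
      qed
      have "\<mu> \<star> (r \<star> a) = (\<Sum>b\<in>Basis. scale (coord b \<mu>) (b \<star> (r \<star> a)))"
        using V_linear_expand[OF V_linear_mul, of "r \<star> a" \<mu>] by (simp add: mul_comm)
      also have "\<dots> = scale (\<Sum>b\<in>Basis. coord b \<mu> * residue b) (r \<star> a)"
        by (simp add: rb scale_sum_left)
      also have "(\<Sum>b\<in>Basis. coord b \<mu> * residue b) = residue \<mu>"
        using dual_expand[OF residue_dual, of \<mu>] by (simp add: mult.commute)
      finally show ?thesis using \<mu> residue_eq_0 by simp
    qed
    then obtain c where c: "r \<star> a = scale c z" using line by blast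
    \<comment> \<open>\<open>r \<star> s\<close> acts on \<open>z\<close> as the nonzero scalar
      \<open>residue (r \<star> s)\<close>; dividing by it turns
      \<open>r \<star> a = scale c z\<close> into an equality of fractions with denominator
      \<open>u\<close>.\<close>
    define c' where "c' = c / residue (r \<star> s)"
    have rs: "residue (r \<star> s) \<noteq> 0" using mul_notin[OF r(1) y(2)] residue_eq_0 by simp
    have "r \<star> (u \<star> a - s \<star> scale c' z) = 0"
    proof -
      have "r \<star> (s \<star> scale c' z) = scale c' ((r \<star> s) \<star> z)"
        by (simp add: mul_assoc mul_scale2)
      also have "\<dots> = scale c z" using rs by (simp add: z_act c'_def)
      finally show ?thesis by (simp add: mul_diff2 mul_unit c)
    qed
    then have "y = loc_frac (\<star>) \<mm> (scale c' z) u"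
      unfolding y(1) using loc_frac_eq_iff[OF y(2) unit_notin] r(1) by blast
    then show "y \<in> {loc_frac (\<star>) \<mm> (scale c z) u | c. True}" by blast
  next
    fix y assume "y \<in> {loc_frac (\<star>) \<mm> (scale c z) u | c. True}"
    then obtain c where y: "y = loc_frac (\<star>) \<mm> (scale c z) u" by blast
    have "loc_frac (\<star>) \<mm> (\<mu> \<star> scale c z) (t \<star> u) = loc_frac (\<star>) \<mm> 0 u"
      if "\<mu> \<in> \<mm>" "t \<notin> \<mm>" for \<mu> t
      using that by (simp add: mul_scale2 z_ann mul_unit2 loc_frac_zero_iff)
        (metis mul_zero2 unit_notin)
    then show "y \<in> loc_socle (\<star>) u \<mm>"
      unfolding loc_socle_def y using unit_notin by blast
  qed
  moreover have "loc_frac (\<star>) \<mm> z u \<noteq> loc_frac (\<star>) \<mm> 0 u"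
    using loc_frac_zero_iff[OF unit_notin] z_loc by blast
  ultimately show ?thesis using unit_notin by blast
qed

end

lemma (in complex_algebra) is_gorensteinI:
  assumes "e \<in> V_dual" "\<And>\<chi>. \<chi> \<in> V_dual \<Longrightarrow> \<exists>z. \<forall>a. \<chi> a = e (z \<star> a)"
  shows "is_gorenstein scale (\<star>) u"
  unfolding is_gorenstein_def
proof (intro allI impI)
  fix \<mm> assume "maximalideal \<mm> (alg_ring (\<star>) u)"
  then have "primeideal \<mm> (alg_ring (\<star>) u)"
    by (rule cring.maximalideal_prime[OF cring_alg_ring])
  then interpret prime_of_algebra scale Basis "(\<star>)" u \<mm>
    by (intro prime_of_algebra.intro complex_algebra_axioms prime_of_algebra_axioms.intro)
  show "\<exists>a s. s \<notin> \<mm> \<and> loc_frac (\<star>) \<mm> a s \<noteq> loc_frac (\<star>) \<mm> 0 u \<and>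
      loc_socle (\<star>) u \<mm> = {loc_frac (\<star>) \<mm> (scale c a) s | c. True}"
    by (rule localization_socle_line[OF assms])
qed


section \<open>The algebra defined by a concise limit of rank-one sums\<close>

lemma (in complex_fd) wlim_shift: "wlim x y \<Longrightarrow> wlim (\<lambda>k. x (k + K)) y"
  unfolding wlim_def by (intro ballI LIMSEQ_ignore_initial_segment) blast

text \<open>Reflexivity: with one slot left open, the form is linear on the dual space and so is
  evaluation at a vector.\<close>

lemma (in complex_fd) tensor_contract_vector:
  assumes T: "is_tensor scale d T" and \<alpha>s: "\<alpha>s \<in> dual_args scale d" and i: "i < d"
  shows "\<exists>w. \<forall>\<beta>\<in>V_dual. \<beta> w = T (\<alpha>s[i := \<beta>])"
proof (intro exI ballI)
  fix \<beta> assume \<beta>: "\<beta> \<in> V_dual"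
  show "\<beta> (\<Sum>b\<in>Basis. scale (T (\<alpha>s[i := coord b])) b) = T (\<alpha>s[i := \<beta>])"
    unfolding tensor_expand[OF T \<alpha>s i \<beta>] by (simp only: dual_sum[OF \<beta>] dual_scale[OF \<beta>] mult.commute)
qed

section \<open>The inverse \<open>P\<close> of the contracted matrix, where
  \<open>q = d - 2\<close>\<close>

locale full_contraction = complex_fd scale Basis
  for scale :: "complex \<Rightarrow> 'v::ab_group_add \<Rightarrow> 'v" and Basis :: "'v set" +
  fixes T :: "'v tensor" and q :: nat and l :: "'v \<Rightarrow> complex"
  assumes sym: "is_symmetric_tensor scale (q + 2) T"
    and l_dual: "l \<in> V_dual"
    and full: "\<exists>\<alpha>\<in>V_dual. \<forall>\<beta>\<in>V_dual. \<beta> w = T (replicate q l @ [\<alpha>, \<beta>])"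
begin

lemma tensor: "is_tensor scale (q + 2) T"
  using sym by (simp add: is_symmetric_tensor_def)

lemma args: "length as = q \<Longrightarrow> set as \<subseteq> V_dual \<Longrightarrow> \<alpha> \<in> V_dual \<Longrightarrow> \<beta> \<in> V_dual \<Longrightarrow>
    as @ [\<alpha>, \<beta>] \<in> dual_args scale (q + 2)"
  by (auto simp: dual_args_iff)

lemma args_l: "\<alpha> \<in> V_dual \<Longrightarrow> \<beta> \<in> V_dual \<Longrightarrow> replicate q l @ [\<alpha>, \<beta>] \<in> dual_args scale (q + 2)"
  using l_dual by (intro args) (auto simp: set_replicate_conv_if)

lemma args_upd: "\<gamma> \<in> V_dual \<Longrightarrow> \<alpha> \<in> V_dual \<Longrightarrow> \<beta> \<in> V_dual \<Longrightarrow>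
    (replicate q l)[i := \<gamma>] @ [\<alpha>, \<beta>] \<in> dual_args scale (q + 2)"
proof (intro args)
  assume "\<gamma> \<in> V_dual"
  then show "set ((replicate q l)[i := \<gamma>]) \<subseteq> V_dual"
    using l_dual by (intro set_update_subsetI) (auto simp: set_replicate_conv_if)
qed simp_all

definition P :: "'v \<Rightarrow> 'v \<Rightarrow> complex" where
  "P x = (SOME \<alpha>. \<alpha> \<in> V_dual \<and> (\<forall>\<beta>\<in>V_dual. \<beta> x = T (replicate q l @ [\<alpha>, \<beta>])))"

lemma P_props: "P x \<in> V_dual \<and> (\<forall>\<beta>\<in>V_dual. \<beta> x = T (replicate q l @ [P x, \<beta>]))"
proof -
  have "\<exists>\<alpha>. \<alpha> \<in> V_dual \<and> (\<forall>\<beta>\<in>V_dual. \<beta> x = T (replicate q l @ [\<alpha>, \<beta>]))"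
    using full[of x] by blast
  then show ?thesis unfolding P_def by (rule someI_ex)
qed

lemma P_dual: "P x \<in> V_dual"
  and P_spec: "\<beta> \<in> V_dual \<Longrightarrow> T (replicate q l @ [P x, \<beta>]) = \<beta> x"
  using P_props by auto

lemma T_swap: "\<alpha> \<in> V_dual \<Longrightarrow> \<beta> \<in> V_dual \<Longrightarrow>
    T (replicate q l @ [\<alpha>, \<beta>]) = T (replicate q l @ [\<beta>, \<alpha>])"
  by (rule symmetric_tensor_mset[OF sym args_l]) simp_all

text \<open>Both sides are the value of the symmetric contraction at \<open>P x\<close> and
  \<open>P y\<close>.\<close>

lemma P_sym: "P x y = P y x"
  using P_spec[OF P_dual[of x], of y] P_spec[OF P_dual[of y], of x] T_swap[OF P_dual P_dual]
  by simp

text \<open>Testing against \<open>P w\<close> for every \<open>w\<close> recovers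
  \<open>\<alpha> w\<close>, so injectivity of the contraction comes from its surjectivity and
  symmetry.\<close>

lemma P_unique:
  assumes \<alpha>: "\<alpha> \<in> V_dual" and x: "\<And>\<beta>. \<beta> \<in> V_dual \<Longrightarrow> \<beta> x = T (replicate q l @ [\<alpha>, \<beta>])"
  shows "P x = \<alpha>"
proof
  fix w
  show "P x w = \<alpha> w"
    using x[OF P_dual[of w]] T_swap[OF \<alpha> P_dual[of w]] P_spec[OF \<alpha>, of w] P_sym[of x w] by simp
qed

text \<open>The trivial coefficients match the shape of the linear combinations in \<^const>\<open>is_tensor\<close>.\<close>

lemma P_add: "P (x + y) = (\<lambda>w. 1 * P x w + 1 * P y w)"
  using dual_add[OF P_dual] by (simp add: fun_eq_iff P_sym[of _ _])

lemma P_scale: "P (scale c x) = (\<lambda>w. c * P x w + 0 * P x w)"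
  using dual_scale[OF P_dual] by (simp add: fun_eq_iff P_sym[of _ _])

lemma P_surj: "\<alpha> \<in> V_dual \<Longrightarrow> \<exists>x. P x = \<alpha>"
proof -
  assume \<alpha>: "\<alpha> \<in> V_dual"
  have "\<exists>w. \<forall>\<beta>\<in>V_dual. \<beta> w = T ((replicate q l @ [\<alpha>, \<alpha>])[q + 1 := \<beta>])"
    by (rule tensor_contract_vector[OF tensor args_l]) (use \<alpha> in simp_all)
  then show ?thesis using P_unique[OF \<alpha>] by (auto simp: list_update_append)
qed

lemma P_inj: "P x = P y \<Longrightarrow> x = y"
  by (rule dual_eqI) (metis P_spec)

lemma P_fun_dual: "(\<lambda>x. P x w) \<in> V_dual"
proof -
  have "(\<lambda>x. P x w) = P w" by (rule ext) (rule P_sym)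
  then show ?thesis using P_dual[of w] by simp
qed

text \<open>All \<open>\<phi> i\<close> are taken to be \<open>P\<close>, which is its own transpose
  by \<open>P_sym\<close>, and \<open>\<psi>\<close> is the identity. Of the \<open>q + 1\<close>
  algebra arguments the last is split off as \<open>x\<close>; \<open>w\<close> is the element that
  ends the fold, in applications the unit.\<close>

lemma is_structure_tensorI:
  assumes T: "\<And>ws x \<beta>. length ws = q \<Longrightarrow> \<beta> \<in> V_dual \<Longrightarrow>
    T (map P ws @ [P x, \<beta>]) = \<beta> (foldr m ws (m x w))"
  shows "is_structure_tensor_of scale (q + 2) T scale m w"
  unfolding is_structure_tensor_of_def structure_tensor_def
proof (intro exI[of _ "\<lambda>_. P"] exI[of _ id] conjI allI impI ballI)
  have "\<alpha> \<in> range P" if "\<alpha> \<in> V_dual" for \<alpha>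
    using P_surj[OF that] by blast
  then show "bij_betw P UNIV (dual scale)"
    using P_inj P_dual by (auto simp: bij_betw_def inj_def)
  show "Vector_Spaces.linear scale (*) (\<lambda>v. P v a)" for a
    using P_fun_dual by (simp add: dual_def)
  show "Vector_Spaces.linear scale scale id"
    by (rule linearI_V) simp_all
  fix as :: "'v list" and \<alpha> :: "'v \<Rightarrow> complex"
  assume as: "length as = q + 2 - 1" and \<alpha>: "\<alpha> \<in> dual scale"
  have "(\<lambda>v. P v a) = P a" for a
    by (rule ext) (rule P_sym)
  then have "map (\<lambda>i v. P v (as ! i)) [0..<q + 2 - 1] = map (\<lambda>i. P (as ! i)) [0..<length as]"
    unfolding as by simp
  also have "\<dots> = map P (map ((!) as) [0..<length as])"
    by simp
  finally have eq: "map (\<lambda>i v. P v (as ! i)) [0..<q + 2 - 1] = map P as"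
    unfolding map_nth .
  obtain ws x where "as = ws @ [x]" "length ws = q"
    using as by (cases as rule: rev_cases) auto
  then show "T (map (\<lambda>i v. P v (as ! i)) [0..<q + 2 - 1] @ [\<alpha> \<circ> id]) = \<alpha> (foldr m as w)"
    unfolding eq using T[of ws \<alpha> x] \<alpha> by simp
qed simp_all

end

text \<open>
  With \<open>q = d - 2\<close>, the vectors \<open>v k j i\<close>, \<open>i < q + 2\<close>, are the factors of the \<open>j\<close>-th
  rank-one summand of the \<open>k\<close>-th approximation.
\<close>

locale concise_limit = full_contraction scale Basis T q l
  for scale :: "complex \<Rightarrow> 'v::ab_group_add \<Rightarrow> 'v" and Basis :: "'v set" and T q l +
  fixes v :: "nat \<Rightarrow> nat \<Rightarrow> nat \<Rightarrow> 'v"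
  assumes q_pos: "0 < q"
    and lim: "\<alpha>s \<in> dual_args scale (q + 2) \<Longrightarrow>
      (\<lambda>k. \<Sum>j<card Basis. \<Prod>i<q + 2. (\<alpha>s ! i) (v k j i)) \<longlonglongrightarrow> T \<alpha>s"
begin

abbreviation "n \<equiv> card Basis"

section \<open>The product, its unit and its pairing\<close>

definition unit :: 'v where "unit = (SOME x. P x = l)"

lemma P_unit: "P unit = l"
  unfolding unit_def by (rule someI_ex) (rule P_surj[OF l_dual])

definition mul :: "'v \<Rightarrow> 'v \<Rightarrow> 'v" (infixl "\<star>" 70) where
  "x \<star> y = (SOME w. \<forall>\<beta>\<in>V_dual. \<beta> w = T ((replicate q l)[0 := P x] @ [P y, \<beta>]))"

lemma mul_spec0:
  assumes "\<beta> \<in> V_dual" shows "T ((replicate q l)[0 := P x] @ [P y, \<beta>]) = \<beta> (x \<star> y)"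
proof -
  have "\<exists>w. \<forall>\<beta>\<in>V_dual. \<beta> w = T (((replicate q l)[0 := P x] @ [P y, l])[q + 1 := \<beta>])"
    by (rule tensor_contract_vector[OF tensor args_upd]) (auto intro: P_dual l_dual)
  then have "\<exists>w. \<forall>\<beta>\<in>V_dual. \<beta> w = T ((replicate q l)[0 := P x] @ [P y, \<beta>])"
    by (simp add: list_update_append)
  from someI_ex[OF this] show ?thesis using assms unfolding mul_def by simp
qed

text \<open>Symmetry lets \<open>P x\<close> sit in any of the first \<open>q\<close> slots; the
  multiplication in the structure tensor uses each of them once.\<close>

lemma mul_spec:
  assumes \<beta>: "\<beta> \<in> V_dual" and i: "i < q"
  shows "T ((replicate q l)[i := P x] @ [P y, \<beta>]) = \<beta> (x \<star> y)"
proof -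
  have "T ((replicate q l)[i := P x] @ [P y, \<beta>]) = T ((replicate q l)[0 := P x] @ [P y, \<beta>])"
    using i by (intro symmetric_tensor_mset[OF sym args_upd] P_dual \<beta>) (simp add: mset_update)
  then show ?thesis using mul_spec0[OF \<beta>] by simp
qed

lemma mul_commute: "x \<star> y = y \<star> x"
proof (rule dual_eqI)
  fix \<beta> assume \<beta>: "\<beta> \<in> V_dual"
  have "T ((replicate q l)[0 := P x] @ [P y, \<beta>]) = T ((replicate q l)[0 := P y] @ [P x, \<beta>])"
    using q_pos by (intro symmetric_tensor_mset[OF sym args_upd] P_dual \<beta>) (simp add: mset_update)
  then show "\<beta> (x \<star> y) = \<beta> (y \<star> x)" by (simp add: mul_spec0[OF \<beta>])
qed

lemma unit_mul: "unit \<star> x = x"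
proof (rule dual_eqI)
  fix \<beta> assume \<beta>: "\<beta> \<in> V_dual"
  have "(replicate q l)[0 := l] = replicate q l"
    using q_pos by (cases q) auto
  then show "\<beta> (unit \<star> x) = \<beta> x"
    using mul_spec0[OF \<beta>, of unit x] P_spec[OF \<beta>, of x] by (simp add: P_unit)
qed

text \<open>Linearity of \<open>T\<close> in slot 0, in a form that yields additivity and
  homogeneity of the product together.\<close>

lemma mul_combination:
  assumes P: "P x' = (\<lambda>w. b * P x w + c * P y w)"
  shows "x' \<star> z = scale b (x \<star> z) + scale c (y \<star> z)"
proof (rule dual_eqI)
  fix \<beta> assume \<beta>: "\<beta> \<in> V_dual"
  have upd: "(replicate q l @ [P z, \<beta>])[0 := \<gamma>] = (replicate q l)[0 := \<gamma>] @ [P z, \<beta>]" for \<gamma>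
    using q_pos by (simp add: list_update_append)
  have "\<beta> (x' \<star> z) = b * \<beta> (x \<star> z) + c * \<beta> (y \<star> z)"
    using tensor_lincomb[OF tensor args_l[OF P_dual[of z] \<beta>] _ P_dual[of x] P_dual[of y], of 0 b c]
    unfolding upd by (simp add: P[symmetric] mul_spec0[OF \<beta>])
  then show "\<beta> (x' \<star> z) = \<beta> (scale b (x \<star> z) + scale c (y \<star> z))"
    by (simp add: dual_add[OF \<beta>] dual_scale[OF \<beta>])
qed

lemma mul_distrib: "(x + y) \<star> z = x \<star> z + y \<star> z"
  using mul_combination[OF P_add] by simp

lemma mul_scaled: "scale c x \<star> z = scale c (x \<star> z)"
  using mul_combination[OF P_scale] by simp

lemma V_linear_mult: "V_linear ((\<star>) x)"
  by (rule linearI_V) (metis mul_commute mul_distrib, metis mul_commute mul_scaled)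

text \<open>Exchanging the \<open>l\<close> of the last slot with the \<open>P x\<close> of slot 0
  restores the full contraction. This makes \<open>l\<close> the nondegenerate form of the
  Gorenstein criterion.\<close>

lemma l_mul: "l (x \<star> y) = P x y"
proof -
  have "T ((replicate q l)[0 := P x] @ [P y, l]) = T (replicate q l @ [P x, P y])"
    using q_pos by (intro symmetric_tensor_mset[OF sym args_l] P_dual) (simp add: mset_update)
  then show ?thesis
    using mul_spec0[OF l_dual, of x y] P_spec[OF P_dual[of y], of x] P_sym by simp
qed

section \<open>The approximations contracted with \<open>l\<close>\<close>

definition f :: "nat \<Rightarrow> nat \<Rightarrow> 'v \<Rightarrow> complex" where
  "f k j x = (\<Prod>i<q. l (v k j i)) * P x (v k j q)"

text \<open>The contracted \<open>k\<close>-th approximation composed with \<open>P\<close>, so it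
  tends to the identity; \<open>f k j x\<close> is the coefficient of the last factor of the
  \<open>j\<close>-th summand.\<close>

definition Q :: "nat \<Rightarrow> 'v \<Rightarrow> 'v" where
  "Q k x = (\<Sum>j<n. scale (f k j x) (v k j (Suc q)))"

lemma f_dual: "f k j \<in> V_dual"
  unfolding f_def[abs_def] by (intro dual_scaled P_fun_dual)

lemma V_linear_Q: "V_linear (Q k)"
  by (rule linearI_V)
    (simp_all add: Q_def dual_add[OF f_dual] dual_scale[OF f_dual] scale_left_distrib sum.distrib
      scale_sum_right)

lemma approx_limit:
  assumes "length as = q" "set as \<subseteq> V_dual" "\<beta> \<in> V_dual"
  shows "(\<lambda>k. \<Sum>j<n. (\<Prod>i<q. (as ! i) (v k j i)) * P x (v k j q) * \<beta> (v k j (Suc q)))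
    \<longlonglongrightarrow> T (as @ [P x, \<beta>])"
proof -
  have "(\<Prod>i<q + 2. ((as @ [P x, \<beta>]) ! i) (v k j i)) =
      (\<Prod>i<q. (as ! i) (v k j i)) * P x (v k j q) * \<beta> (v k j (Suc q))" for k j
    using assms(1) by (simp add: nth_append)
  then show ?thesis using lim[OF args[OF assms(1,2) P_dual assms(3)], of x] by simp
qed

lemma Q_limit: "wlim (\<lambda>k. Q k x) x"
proof (rule wlimI)
  fix \<beta> assume \<beta>: "\<beta> \<in> V_dual"
  have "\<beta> (Q k x) = (\<Sum>j<n. (\<Prod>i<q. (replicate q l ! i) (v k j i)) * P x (v k j q) * \<beta> (v k j (Suc q)))"
    for k
    by (simp add: Q_def dual_sum[OF \<beta>] dual_scale[OF \<beta>] f_def)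
  then show "(\<lambda>k. \<beta> (Q k x)) \<longlonglongrightarrow> \<beta> x"
    using approx_limit[of "replicate q l" \<beta> x] l_dual \<beta> P_spec[OF \<beta>]
    by (simp add: set_replicate_conv_if)
qed

lemma Q_eventually_inj: "eventually (\<lambda>k. inj (Q k)) sequentially"
  by (rule near_identity_inj[OF V_linear_Q Q_limit])

end

text \<open>
  For injective \<open>Q k\<close>, the functionals \<open>f k j\<close> are coordinates on \<open>V\<close>. In these coordinates the
  contraction of the \<open>k\<close>-th approximation with \<open>l\<close> in all slots but \<open>i\<close> and the last two is diagonal,
  which is why the limiting multiplications commute.
\<close>

locale concise_limit_inj = concise_limit +
  assumes inj_Q: "inj (Q k)"
begin

definition diag :: "(nat \<Rightarrow> complex) \<Rightarrow> nat \<Rightarrow> complex" where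
  "diag t = (\<lambda>j. if j < n then t j else 0)"

lemma diag_std: "diag t \<in> std_space n"
  by (simp add: diag_def std_space_def)

definition F :: "nat \<Rightarrow> 'a \<Rightarrow> nat \<Rightarrow> complex" where
  "F k x = diag (\<lambda>j. f k j x)"

text \<open>\<open>Q k x\<close> depends on \<open>x\<close> only through the \<open>n\<close>
  numbers \<open>f k j x\<close>.\<close>

lemma inj_F: "inj (F k)"
proof (rule injI)
  fix x y assume "F k x = F k y"
  then have "f k j x = f k j y" if "j < n" for j
    using that by (auto simp: F_def diag_def fun_eq_iff split: if_splits)
  then have "Q k x = Q k y" by (simp add: Q_def)
  then show "x = y" using inj_Q by (auto dest: injD)
qed

lemma bij_F: "bij_betw (F k) UNIV (std_space n)"
proof (rule injective_coordinates_bij[OF _ _ inj_F])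
  fix i show "(\<lambda>x. F k x i) \<in> V_dual"
    by (cases "i < n") (simp_all add: F_def diag_def f_dual zero_dual)
qed (simp add: F_def diag_def)

text \<open>Truncation by \<open>diag\<close> admits an arbitrary \<open>t\<close>, of which only
  the first \<open>n\<close> values count.\<close>

definition Finv :: "nat \<Rightarrow> (nat \<Rightarrow> complex) \<Rightarrow> 'a" where
  "Finv k t = inv_into UNIV (F k) (diag t)"

lemma F_Finv: "F k (Finv k t) = diag t"
  unfolding Finv_def by (rule bij_betw_inv_into_right[OF bij_F diag_std])

lemma f_Finv: "j < n \<Longrightarrow> f k j (Finv k t) = t j"
  using fun_cong[OF F_Finv, of k t j] by (simp add: F_def diag_def)

lemma Finv_eqI: "(\<And>j. j < n \<Longrightarrow> f k j x = t j) \<Longrightarrow> Finv k t = x"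
proof (rule injD[OF inj_F[of k]], rule ext)
  fix j
  assume "\<And>j. j < n \<Longrightarrow> f k j x = t j"
  then show "F k (Finv k t) j = F k x j"
    unfolding F_Finv by (simp add: F_def diag_def)
qed

text \<open>The \<open>f k j\<close> are coordinates, so none is the zero functional, whereas each
  \<open>l (v k j i)\<close> is a factor of \<open>f k j\<close>.\<close>

lemma l_nonzero:
  assumes "j < n" "i < q" shows "l (v k j i) \<noteq> 0"
proof
  assume "l (v k j i) = 0"
  then have "f k j x = 0" for x
    using assms(2) by (auto simp: f_def prod_zero_iff)
  then show False using f_Finv[OF assms(1), of k "\<lambda>_. 1"] by simp
qed

text \<open>The factor by which the \<open>j\<close>-th summand changes when \<open>P x\<close>
  replaces \<open>l\<close> in slot \<open>i\<close>.\<close>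

definition ev :: "nat \<Rightarrow> nat \<Rightarrow> 'a \<Rightarrow> nat \<Rightarrow> complex" where
  "ev k i x j = P x (v k j i) / l (v k j i)"

lemma ev_dual: "(\<lambda>x. ev k i x j) \<in> V_dual"
  unfolding ev_def divide_inverse mult.commute[of _ "inverse _"]
  by (intro dual_scaled P_fun_dual)

text \<open>An approximate multiplication by \<open>x\<close> through slot \<open>i\<close>: the
  operator that is diagonal in the coordinates \<open>f k j\<close> with eigenvalues
  \<open>ev k i x j\<close>.\<close>

definition D :: "nat \<Rightarrow> nat \<Rightarrow> 'a \<Rightarrow> 'a \<Rightarrow> 'a" where
  "D k i x y = Finv k (\<lambda>j. ev k i x j * f k j y)"

lemma f_D: "j < n \<Longrightarrow> f k j (D k i x y) = ev k i x j * f k j y"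
  by (simp add: D_def f_Finv)

lemma D_eqI: "(\<And>j. j < n \<Longrightarrow> f k j z = ev k i x j * f k j y) \<Longrightarrow> D k i x y = z"
  unfolding D_def by (rule Finv_eqI)

lemma V_linear_D: "V_linear (D k i x)"
  by (rule linearI_V; rule D_eqI)
    (simp_all add: dual_add[OF f_dual] dual_scale[OF f_dual] f_D algebra_simps)

lemma V_linear_D1: "V_linear (\<lambda>x. D k i x y)"
  by (rule linearI_V; rule D_eqI)
    (simp_all add: dual_add[OF f_dual] dual_scale[OF f_dual] dual_add[OF ev_dual]
      dual_scale[OF ev_dual] f_D algebra_simps)

lemma dual_Q_Finv:
  "\<beta> \<in> V_dual \<Longrightarrow> \<beta> (Q k (Finv k t)) = (\<Sum>j<n. t j * \<beta> (v k j (Suc q)))"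
  by (simp add: Q_def dual_sum dual_scale f_Finv)

text \<open>\<open>Q k (D k i x y)\<close> is the \<open>k\<close>-th approximation with
  \<open>P x\<close> in slot \<open>i\<close>, \<open>P y\<close> in slot \<open>q\<close> and the
  last slot open, so it tends to \<open>x \<star> y\<close>; \<open>Q k\<close> is then
  cancelled.\<close>

lemma D_limit:
  assumes i: "i < q" shows "wlim (\<lambda>k. D k i x y) (x \<star> y)"
proof (rule near_identity_preimage[OF V_linear_Q Q_limit], rule wlimI)
  fix \<beta> assume \<beta>: "\<beta> \<in> V_dual"
  let ?as = "(replicate q l)[i := P x]"
  \<comment> \<open>Only the factor at slot \<open>i\<close> changes, and \<open>l_nonzero\<close>
    permits the division in \<open>ev\<close>.\<close>
  have "(\<Prod>i<q. (?as ! i) (v k j i)) = ev k i x j * (\<Prod>i<q. l (v k j i))" if j: "j < n" for k j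
  proof -
    have "(\<Prod>i<q. (?as ! i) (v k j i)) = P x (v k j i) * (\<Prod>i\<in>{..<q} - {i}. (?as ! i) (v k j i))"
      using i by (subst prod.remove[of _ i]) auto
    also have "(\<Prod>i\<in>{..<q} - {i}. (?as ! i) (v k j i)) = (\<Prod>i\<in>{..<q} - {i}. l (v k j i))"
      by (rule prod.cong) auto
    also have "P x (v k j i) * \<dots> = ev k i x j * (l (v k j i) * (\<Prod>i\<in>{..<q} - {i}. l (v k j i)))"
      using l_nonzero[OF j i] by (simp add: ev_def)
    also have "l (v k j i) * (\<Prod>i\<in>{..<q} - {i}. l (v k j i)) = (\<Prod>i<q. l (v k j i))"
      using i by (subst prod.remove[of "{..<q}" i]) auto
    finally show ?thesis .
  qed
  then have "\<beta> (Q k (D k i x y)) =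
      (\<Sum>j<n. (\<Prod>i<q. (?as ! i) (v k j i)) * P y (v k j q) * \<beta> (v k j (Suc q)))" for k
    unfolding D_def dual_Q_Finv[OF \<beta>] by (intro sum.cong) (auto simp: f_def)
  moreover have "set ?as \<subseteq> V_dual"
    using l_dual P_dual by (intro set_update_subsetI) (auto simp: set_replicate_conv_if)
  ultimately show "(\<lambda>k. \<beta> (Q k (D k i x y))) \<longlonglongrightarrow> \<beta> (x \<star> y)"
    using approx_limit[of ?as \<beta> y] \<beta> mul_spec[OF \<beta> i] by simp
qed

lemma D_comm: "D k i x (D k i y z) = D k i y (D k i x z)"
  by (rule D_eqI) (simp add: f_D)

text \<open>Diagonal operators commute, so one sequence has both sides as limits. Together with
  commutativity this gives associativity.\<close>

lemma mul_lcomm: "x \<star> (y \<star> z) = y \<star> (x \<star> z)"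
proof (rule wlim_unique)
  have *: "wlim (\<lambda>k. D k 0 x (D k 0 y z)) (x \<star> (y \<star> z))" for x y z
    by (rule wlim_apply[where N = "\<lambda>k. D k 0 x" and N' = "(\<star>) x",
          OF V_linear_D V_linear_mult D_limit[OF q_pos] D_limit[OF q_pos]])
  show "wlim (\<lambda>k. D k 0 x (D k 0 y z)) (x \<star> (y \<star> z))" by (rule *)
  show "wlim (\<lambda>k. D k 0 x (D k 0 y z)) (y \<star> (x \<star> z))" by (subst D_comm) (rule *)
qed

lemma complex_algebra_mul: "complex_algebra scale Basis (\<star>) unit"
proof (intro complex_algebra.intro complex_fd_axioms complex_algebra_axioms.intro)
  show "(x \<star> y) \<star> z = x \<star> (y \<star> z)" for x y z
    by (metis mul_commute mul_lcomm)
qed (fact mul_commute unit_mul mul_distrib mul_scaled)+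

lemma is_gorenstein_mul: "is_gorenstein scale (\<star>) unit"
proof (rule complex_algebra.is_gorensteinI[OF complex_algebra_mul l_dual])
  show "\<exists>z. \<forall>a. \<chi> a = l (z \<star> a)" if "\<chi> \<in> V_dual" for \<chi>
    using P_surj[OF that] by (auto simp: l_mul)
qed

text \<open>Eigenvalues are used as coordinates here because they multiply under composition of the
  operators \<open>D k 0 x\<close>.\<close>

definition g :: "nat \<Rightarrow> 'a \<Rightarrow> nat \<Rightarrow> complex" where
  "g k x = diag (ev k 0 x)"

text \<open>Applying the operators to the unit gives maps \<open>N k\<close> that tend to the
  identity and factor through \<open>g k\<close>, so \<open>g k\<close> is injective for large
  \<open>k\<close>. \<open>N k\<close> sends the transported product of \<open>x\<close> and
  \<open>y\<close> to the composite of their operators applied to the unit, which tends to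
  \<open>x \<star> y\<close>.\<close>

lemma is_smoothable_mul: "is_smoothable scale (\<star>)"
proof -
  define N where "N = (\<lambda>k z. D k 0 z unit)"
  have N_lin: "V_linear (N k)" for k
    unfolding N_def by (rule V_linear_D1)
  have N_lim: "wlim (\<lambda>k. N k z) z" for z
    using D_limit[OF q_pos, of z unit] by (simp add: N_def mul_commute[of z] unit_mul)
  obtain K where K: "\<And>k. k \<ge> K \<Longrightarrow> inj (N k)"
    using near_identity_inj[OF N_lin N_lim] by (auto simp: eventually_sequentially)
  have g_dual: "(\<lambda>x. g k x i) \<in> V_dual" for k i
    by (cases "i < n") (simp_all add: g_def diag_def ev_dual zero_dual)
  have N_g: "N k z = Finv k (\<lambda>j. g k z j * f k j unit)" for k z
    unfolding N_def by (rule D_eqI) (simp add: f_Finv g_def diag_def)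
  \<comment> \<open>The shift by \<open>K\<close> drops the terms where \<open>g k\<close> may fail
    to be injective, since smoothability asks for isomorphisms at every index.\<close>
  have bij_g: "bij_betw (g (k + K)) UNIV (std_space n)" for k
  proof (rule injective_coordinates_bij[OF g_dual])
    show "inj (g (k + K))"
    proof (rule injI)
      fix x y assume "g (k + K) x = g (k + K) y"
      then have "N (k + K) x = N (k + K) y" by (simp add: N_g)
      then show "x = y" using K[of "k + K"] by (auto dest: injD)
    qed
  qed (simp add: g_def diag_def)
  have "wlim (\<lambda>k. inv_into UNIV (g (k + K)) (\<lambda>i. g (k + K) x i * g (k + K) y i)) (x \<star> y)" for x y
  proof (rule near_identity_preimage[OF N_lin wlim_shift[OF N_lim]])
    define \<mu> where "\<mu> = (\<lambda>k. inv_into UNIV (g (k + K)) (\<lambda>i. g (k + K) x i * g (k + K) y i))"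
    have "(\<lambda>i. g k x i * g k y i) \<in> std_space n" for k
      by (simp add: std_space_def g_def diag_def)
    then have "g (k + K) (\<mu> k) = (\<lambda>i. g (k + K) x i * g (k + K) y i)" for k
      unfolding \<mu>_def by (rule bij_betw_inv_into_right[OF bij_g])
    then have "N (k + K) (\<mu> k) = D (k + K) 0 x (D (k + K) 0 y unit)" for k
      unfolding N_g by (intro Finv_eqI) (simp add: f_D g_def diag_def)
    moreover have "wlim (\<lambda>k. D (k + K) 0 x (D (k + K) 0 y unit)) (x \<star> (y \<star> unit))"
      by (rule wlim_apply[where N = "\<lambda>k. D (k + K) 0 x" and N' = "(\<star>) x",
            OF V_linear_D V_linear_mult wlim_shift[OF D_limit[OF q_pos]] wlim_shift[OF D_limit[OF q_pos]]])
    ultimately show "wlim (\<lambda>k. N (k + K) (\<mu> k)) (x \<star> y)"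
      by (simp add: mul_commute[of y] unit_mul)
  qed
  note lim = this
  have "Vector_Spaces.linear scale (*) (\<lambda>x. g k x i)" for k i
    using g_dual by (simp add: dual_def)
  then show ?thesis
    unfolding is_smoothable_def dim_UNIV
    by (intro exI[of _ "\<lambda>k. g (k + K)"] conjI allI ballI bij_g wlimD[OF lim])
qed

text \<open>Both sides are limits of one sequence: applying the operators of all slots to
  \<open>x\<close> and then \<open>Q k\<close> gives the \<open>k\<close>-th approximation at
  \<open>map P ws\<close> and \<open>P x\<close>.\<close>

lemma T_eq_product:
  assumes ws: "length ws = q" and \<beta>: "\<beta> \<in> V_dual"
  shows "T (map P ws @ [P x, \<beta>]) = \<beta> (foldr (\<star>) ws x)"
proof -
  \<comment> \<open>\<open>W p k\<close> results from \<open>x\<close> by the operators of slots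
    \<open>p\<close> to \<open>q - 1\<close>; induction downwards from \<open>p = q\<close> adds one
    operator at a time.\<close>
  define W where "W = (\<lambda>p k. Finv k (\<lambda>j. (\<Prod>i=p..<q. ev k i (ws ! i) j) * f k j x))"
  have W_lim: "wlim (W p) (foldr (\<star>) (drop p ws) x)" if "p \<le> q" for p
    using that
  proof (induction rule: inc_induct)
    case base
    have "W q k = x" for k unfolding W_def by (rule Finv_eqI) simp
    then have "W q = (\<lambda>_. x)" by (simp add: fun_eq_iff)
    then show ?case using ws by (simp add: wlim_const)
  next
    case (step p)
    have "W p k = D k p (ws ! p) (W (Suc p) k)" for k
      unfolding W_def using step(2)
      by (intro Finv_eqI) (simp add: f_D f_Finv prod.atLeast_Suc_lessThan)
    then have "W p = (\<lambda>k. D k p (ws ! p) (W (Suc p) k))" by (simp add: fun_eq_iff)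
    moreover have "drop p ws = ws ! p # drop (Suc p) ws"
      using step(2) ws by (simp add: Cons_nth_drop_Suc)
    moreover have "wlim (\<lambda>k. D k p (ws ! p) (W (Suc p) k)) (ws ! p \<star> foldr (\<star>) (drop (Suc p) ws) x)"
      by (rule wlim_apply[where N = "\<lambda>k. D k p (ws ! p)" and N' = "(\<star>) (ws ! p)",
            OF V_linear_D V_linear_mult D_limit[OF step(2)] step(3)])
    ultimately show ?case by simp
  qed
  have "wlim (\<lambda>k. Q k (W 0 k)) (foldr (\<star>) ws x)"
    using wlim_apply[where N = Q and N' = "\<lambda>x. x", OF V_linear_Q linearI_V Q_limit W_lim[of 0]]
    by simp
  then have 1: "(\<lambda>k. \<beta> (Q k (W 0 k))) \<longlonglongrightarrow> \<beta> (foldr (\<star>) ws x)"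
    using \<beta> by (rule wlimD)
  \<comment> \<open>The denominators of the eigenvalues cancel the \<open>l\<close> factors
    contained in \<open>f k j x\<close>.\<close>
  have "(\<Prod>i<q. ev k i (ws ! i) j) * (\<Prod>i<q. l (v k j i)) = (\<Prod>i<q. P (ws ! i) (v k j i))"
    if "j < n" for k j
    unfolding prod.distrib[symmetric] using l_nonzero[OF that]
    by (intro prod.cong) (auto simp: ev_def)
  then have "\<beta> (Q k (W 0 k)) =
      (\<Sum>j<n. (\<Prod>i<q. (map P ws ! i) (v k j i)) * P x (v k j q) * \<beta> (v k j (Suc q)))" for k
    unfolding W_def dual_Q_Finv[OF \<beta>] using ws
    by (intro sum.cong refl) (simp add: f_def atLeast0LessThan mult.assoc[symmetric])
  then have "(\<lambda>k. \<beta> (Q k (W 0 k))) \<longlonglongrightarrow> T (map P ws @ [P x, \<beta>])"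
    using approx_limit[of "map P ws" \<beta> x] ws \<beta> P_dual by auto
  then show ?thesis using 1 LIMSEQ_unique by blast
qed

lemma is_structure_tensor_mul: "is_structure_tensor_of scale (q + 2) T scale (\<star>) unit"
  by (rule is_structure_tensorI) (simp add: T_eq_product mul_commute[of _ unit] unit_mul)

lemmas structure_algebra =
  complex_algebra.is_algebra_mul[OF complex_algebra_mul] is_smoothable_mul is_gorenstein_mul
  is_structure_tensor_mul

end


section \<open>The coordinatewise product\<close>

context complex_fd
begin

definition cmul :: "'v \<Rightarrow> 'v \<Rightarrow> 'v" where
  "cmul x y = (\<Sum>b\<in>Basis. scale (coord b x * coord b y) b)"

lemma coord_lincomb:
  assumes b: "b \<in> Basis" shows "coord b (\<Sum>c\<in>Basis. scale (h c) c) = h b"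
proof -
  have "coord b (\<Sum>c\<in>Basis. scale (h c) c) = (\<Sum>c\<in>Basis. h c * coord b c)"
    by (simp only: dual_sum[OF coord_dual] dual_scale[OF coord_dual])
  also have "\<dots> = (\<Sum>c\<in>Basis. if c = b then h c else 0)"
    by (rule sum.cong) (auto simp: coord_Basis)
  also have "\<dots> = h b"
    using b finite_Basis by simp
  finally show ?thesis .
qed

lemma coord_cmul: "b \<in> Basis \<Longrightarrow> coord b (cmul x y) = coord b x * coord b y"
  unfolding cmul_def by (rule coord_lincomb)

lemma coord_one: "b \<in> Basis \<Longrightarrow> coord b (\<Sum>Basis) = 1"
  using coord_lincomb[of b "\<lambda>_. 1"] by simp

lemma coord_eqI: "(\<And>b. b \<in> Basis \<Longrightarrow> coord b x = coord b y) \<Longrightarrow> x = y"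
  by (metis (no_types, lifting) sum.cong sum_coord)

lemma complex_algebra_cmul: "complex_algebra scale Basis cmul (\<Sum>Basis)"
proof (intro complex_algebra.intro complex_fd_axioms complex_algebra_axioms.intro)
  fix x y z c
  show "cmul (cmul x y) z = cmul x (cmul y z)"
    by (rule coord_eqI) (simp add: coord_cmul)
  show "cmul x y = cmul y x"
    by (rule coord_eqI) (simp add: coord_cmul)
  show "cmul (\<Sum>Basis) x = x"
    by (rule coord_eqI) (simp add: coord_cmul coord_one)
  show "cmul (x + y) z = cmul x z + cmul y z"
    by (rule coord_eqI) (simp add: coord_cmul dual_add[OF coord_dual] distrib_right)
  show "cmul (scale c x) y = scale c (cmul x y)"
    by (rule coord_eqI) (simp add: coord_cmul dual_scale[OF coord_dual])
qed

text \<open>The form is the trace of the product algebra; the vector with coordinates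
  \<open>\<chi> b\<close> represents \<open>\<chi>\<close>.\<close>

lemma is_gorenstein_cmul: "is_gorenstein scale cmul (\<Sum>Basis)"
proof (rule complex_algebra.is_gorensteinI[OF complex_algebra_cmul])
  show "(\<lambda>x. \<Sum>b\<in>Basis. coord b x) \<in> V_dual"
    by (intro sum_dual coord_dual)
  show "\<exists>z. \<forall>a. \<chi> a = (\<Sum>b\<in>Basis. coord b (cmul z a))" if \<chi>: "\<chi> \<in> V_dual" for \<chi>
    by (intro exI[of _ "\<Sum>b\<in>Basis. scale (\<chi> b) b"] allI)
      (simp add: coord_cmul coord_lincomb dual_expand[OF \<chi>, symmetric])
qed

text \<open>The coordinates in an enumeration \<open>s\<close> of the basis are already an algebra
  isomorphism, so a constant sequence suffices.\<close>

lemma is_smoothable_cmul: "is_smoothable scale cmul"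
proof -
  obtain s where s: "bij_betw s {..<card Basis} Basis"
    using ex_bij_betw_nat_finite[OF finite_Basis] by (auto simp: atLeast0LessThan)
  define g where "g = (\<lambda>x i. if i < card Basis then coord (s i) x else 0)"
  have sB: "s i \<in> Basis" if "i < card Basis" for i
    using s that by (auto dest: bij_betwE)
  have inj: "inj g"
  proof (rule injI, rule coord_eqI)
    fix x y b assume "g x = g y" "b \<in> Basis"
    moreover obtain i where "i < card Basis" "b = s i"
      using s \<open>b \<in> Basis\<close> by (auto simp: bij_betw_def)
    ultimately show "coord b x = coord b y"
      by (auto simp: g_def fun_eq_iff split: if_splits)
  qed
  have g_dual: "(\<lambda>x. g x i) \<in> V_dual" for i
    by (cases "i < card Basis") (simp_all add: g_def coord_dual zero_dual)
  have bij: "bij_betw g UNIV (std_space (card Basis))"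
    by (rule injective_coordinates_bij[OF g_dual _ inj]) (simp add: g_def)
  have "g (cmul x y) = (\<lambda>i. g x i * g y i)" for x y
    by (auto simp: g_def fun_eq_iff coord_cmul sB)
  then have inv: "inv_into UNIV g (\<lambda>i. g x i * g y i) = cmul x y" for x y
    by (intro inv_into_f_eq[OF inj]) simp_all
  have "Vector_Spaces.linear scale (*) (\<lambda>x. g x i)" for i
    using g_dual by (simp add: dual_def)
  then show ?thesis
    unfolding is_smoothable_def dim_UNIV
    by (intro exI[of _ "\<lambda>_. g"] conjI allI ballI bij) (simp_all add: inv)
qed

section \<open>Full rank as surjectivity of the induced map\<close>

lemma full_rank_surjective:
  assumes M: "is_tensor scale 2 M" and full: "is_full_rank scale M"
  shows "\<exists>\<alpha>\<in>V_dual. \<forall>\<beta>\<in>V_dual. \<beta> w = M [\<alpha>, \<beta>]"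
proof -
  \<comment> \<open>\<open>S\<close> is the image whose dimension is the matrix rank; once it is a
    subspace, full dimension makes it the whole space.\<close>
  define S where "S = {w. \<exists>\<alpha>\<in>V_dual. \<forall>\<beta>\<in>V_dual. \<beta> w = M [\<alpha>, \<beta>]}"
  have lin: "M [(\<lambda>v. b * \<alpha> v + c * \<alpha>' v), \<beta>] = b * M [\<alpha>, \<beta>] + c * M [\<alpha>', \<beta>]"
    if "\<alpha> \<in> V_dual" "\<alpha>' \<in> V_dual" "\<beta> \<in> V_dual" for b c \<alpha> \<alpha>' \<beta>
    using tensor_lincomb[OF M, of "[\<alpha>, \<beta>]" 0 \<alpha> \<alpha>' b c] that by (simp add: dual_args_iff)
  have comb: "scale b x + scale c y \<in> S" if xy: "x \<in> S" "y \<in> S" for b c x y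
  proof -
    obtain \<alpha> \<alpha>' where \<alpha>: "\<alpha> \<in> V_dual" "\<alpha>' \<in> V_dual"
        "\<And>\<beta>. \<beta> \<in> V_dual \<Longrightarrow> \<beta> x = M [\<alpha>, \<beta>]" "\<And>\<beta>. \<beta> \<in> V_dual \<Longrightarrow> \<beta> y = M [\<alpha>', \<beta>]"
      using xy unfolding S_def by blast
    then show ?thesis
      unfolding S_def
      by (intro CollectI bexI[of _ "\<lambda>v. b * \<alpha> v + c * \<alpha>' v"] ballI dual_lincomb)
        (simp_all add: dual_add dual_scale lin)
  qed
  have "M [(\<lambda>_. 0), \<beta>] = 0" if "\<beta> \<in> V_dual" for \<beta>
    using lin[OF that that that, of 0 0] by simp
  then have "0 \<in> S"
    unfolding S_def by (intro CollectI bexI[OF _ zero_dual]) (simp add: dual_zero)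
  then have "subspace S"
    using comb[of _ _ 1 1] comb[of _ 0 _ 0] by (intro subspaceI) simp_all
  moreover have "dim S = dimension"
    using full unfolding is_full_rank_def matrix_rank_def S_def dimension_def by simp
  ultimately have "S = UNIV"
    using dim_eq_full span_eq_iff by metis
  then show ?thesis by (auto simp: S_def)
qed

end

theorem mainTheorem4:
  fixes scale :: "complex \<Rightarrow> 'v::ab_group_add \<Rightarrow> 'v"
    and B :: "'v set"
    and d :: nat
    and T :: "'v tensor"
  assumes "finite_dimensional_vector_space scale B"
    and "d \<ge> 2"
    and "is_symmetric_tensor scale d T"
    and "minimal_border_rank scale d T"
    and "\<exists>l \<in> dual scale. is_symmetric_tensor scale 2 (contract (d - 2) l T) \<and>
           is_full_rank scale (contract (d - 2) l T)"
  shows "\<exists>(mul :: 'v \<Rightarrow> 'v \<Rightarrow> 'v) (u :: 'v).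
           is_algebra scale mul u \<and> is_smoothable scale mul \<and> is_gorenstein scale mul u \<and>
           is_structure_tensor_of scale d T scale mul u"
proof -
  interpret complex_fd scale B
    using assms(1) by (rule complex_fd.intro)
  define q where "q = d - 2"
  have d: "d = q + 2" using assms(2) by (simp add: q_def)
  obtain l where l: "l \<in> V_dual" "is_symmetric_tensor scale 2 (contract q l T)"
      "is_full_rank scale (contract q l T)"
    using assms(5) unfolding q_def by blast
  have "is_tensor scale 2 (contract q l T)"
    using l(2) by (simp add: is_symmetric_tensor_def)
  note full = full_rank_surjective[OF this l(3), unfolded contract_def]
  interpret full_contraction scale B T q l
    by unfold_locales (use assms(3) l(1) full d in auto)
  show ?thesis
  proof (cases "q = 0")
    case True
    \<comment> \<open>With \<open>q = 0\<close> the list \<open>ws\<close> is empty, and the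
      required identity is the defining property of \<open>P\<close>.\<close>
    have "is_structure_tensor_of scale (q + 2) T scale cmul (\<Sum>B)"
    proof (rule is_structure_tensorI)
      fix ws :: "'v list" and x \<beta> assume "length ws = q" "\<beta> \<in> V_dual"
      then show "T (map P ws @ [P x, \<beta>]) = \<beta> (foldr cmul ws (cmul x (\<Sum>B)))"
        using True P_spec[of \<beta> x] complex_algebra.mul_unit2[OF complex_algebra_cmul] by simp
    qed
    then show ?thesis
      using complex_algebra.is_algebra_mul[OF complex_algebra_cmul] is_smoothable_cmul
        is_gorenstein_cmul d by blast
  next
    case False
    have "is_limit_of_rank scale d T (card B)"
      using limit_of_rank_border_rank[of d T] assms(2-4)
      by (simp add: minimal_border_rank_def is_symmetric_tensor_def)
    then obtain D where D: "\<And>k j. j < card B \<Longrightarrow> is_decomposable scale d (D k j)"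
        "\<And>\<alpha>s. \<alpha>s \<in> dual_args scale d \<Longrightarrow> (\<lambda>k. \<Sum>j<card B. D k j \<alpha>s) \<longlonglongrightarrow> T \<alpha>s"
      unfolding is_limit_of_rank_def by blast
    have "\<forall>k j. \<exists>v. j < card B \<longrightarrow>
        (\<forall>\<alpha>s\<in>dual_args scale d. D k j \<alpha>s = (\<Prod>i<d. (\<alpha>s ! i) (v i)))"
      using D(1) unfolding is_decomposable_def by blast
    then obtain v where v: "\<And>k j \<alpha>s. j < card B \<Longrightarrow> \<alpha>s \<in> dual_args scale d \<Longrightarrow>
        D k j \<alpha>s = (\<Prod>i<d. (\<alpha>s ! i) (v k j i))"
      by metis
    have lim: "(\<lambda>k. \<Sum>j<card B. \<Prod>i<q + 2. (\<alpha>s ! i) (v k j i)) \<longlonglongrightarrow> T \<alpha>s"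
      if "\<alpha>s \<in> dual_args scale (q + 2)" for \<alpha>s
      using D(2)[of \<alpha>s] v[of _ \<alpha>s] that unfolding d by simp
    interpret L: concise_limit scale B T q l v
      by unfold_locales (use False lim in auto)
    \<comment> \<open>The first interpretation only provides the index from which \<open>Q k\<close>
      is injective; the approximations are then shifted by \<open>K\<close> to have injectivity at
      every index.\<close>
    obtain K where K: "\<And>k. k \<ge> K \<Longrightarrow> inj (L.Q k)"
      using L.Q_eventually_inj by (auto simp: eventually_sequentially)
    interpret L': concise_limit scale B T q l "\<lambda>k. v (k + K)"
      by unfold_locales (use False LIMSEQ_ignore_initial_segment[OF lim] in auto)
    have "L'.Q k = L.Q (k + K)" for k
      by (simp add: fun_eq_iff L.Q_def L'.Q_def L.f_def L'.f_def)
    then interpret L'': concise_limit_inj scale B T q l "\<lambda>k. v (k + K)"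
      by unfold_locales (simp add: K)
    show ?thesis
      using L''.structure_algebra unfolding d by blast
  qed
qed

end
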